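(* Let $G$ be either $V_{8n} = \langle a,b : a^{2n} = b^4 = 1,\ b^{-1}ab^{-1} = bab = a^{-1}\rangle$ with $n$ an odd positive integer, or $SD_{8n} = \langle a,b : a^{4n} = b^2 = 1,\ bab = a^{2n-1}\rangle$ with $n\ge 2$ an integer. Then $E(\Gamma_{nc}(G)) \leq LE(\Gamma_{nc}(G))$.
   Context: For a finite non-abelian group $G$ with center $Z(G)$, the non-commuting graph $\Gamma_{nc}(G)$ is the simple undirected graph with vertex set $G\setminus Z(G)$, in which two vertices $x,y$ are adjacent if and only if $xy \ne yx$. For a finite simple graph $\mathcal{G}$ with vertex set $v(\mathcal{G})$ and edge set $e(\mathcal{G})$, the energy $E(\mathcal{G})$ is the sum of $|\lambda|$ over the eigenvalues $\lambda$ of the adjacency matrix $\mathcal{A}(\mathcal{G})$, and the Laplacian energy is $LE(\mathcal{G}) = \sum_{\mu}\left|\mu - \frac{2|e(\mathcal{G})|}{|v(\mathcal{G})|}\right|$, the sum over the eigenvalues $\mu$ of the Laplacian matrix $L(\mathcal{G}) = D(\mathcal{G}) - \mathcal{A}(\mathcal{G})$, where $D(\mathcal{G})$ is the diagonal degree matrix; eigenvalues are counted with multiplicity. *)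

theory Defs
  imports
    "HOL-Algebra.Group"
    "HOL-Computational_Algebra.Polynomial"
    "Jordan_Normal_Form.Char_Poly"
begin

datatype 'g letter = Gen 'g | Inv 'g

fun inv_letter :: "'g letter \<Rightarrow> 'g letter" where
  "inv_letter (Gen g) = Inv g"
| "inv_letter (Inv g) = Gen g"

type_synonym 'g word = "'g letter list"

text \<open>A relation \<open>u = v\<close> between words is encoded as the pair \<open>(u, v)\<close>. The group presented by
  a set \<open>R\<close> of relations consists of all words modulo the congruence generated by \<open>R\<close> and
  free cancellation; this is the free group modulo the normal closure of all \<open>u v\<^sup>-\<^sup>1\<close>
  with \<open>(u, v) \<in> R\<close>.\<close>

inductive word_eq :: "('g word \<times> 'g word) set \<Rightarrow> 'g word \<Rightarrow> 'g word \<Rightarrow> bool"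
  for R :: "('g word \<times> 'g word) set" where
  refl: "word_eq R u u"
| sym: "word_eq R u v \<Longrightarrow> word_eq R v u"
| trans: "word_eq R u v \<Longrightarrow> word_eq R v w \<Longrightarrow> word_eq R u w"
| cancel: "word_eq R (p @ [x, inv_letter x] @ q) (p @ q)"
| relation: "(u, v) \<in> R \<Longrightarrow> word_eq R (p @ u @ q) (p @ v @ q)"

definition word_rel :: "('g word \<times> 'g word) set \<Rightarrow> ('g word \<times> 'g word) set" where
  "word_rel R = {(u, v). word_eq R u v}"

definition presented_group :: "('g word \<times> 'g word) set \<Rightarrow> 'g word set monoid" where
  "presented_group R =
    \<lparr>carrier = UNIV // word_rel R,
     mult = (\<lambda>X Y. \<Union>x\<in>X. \<Union>y\<in>Y. word_rel R `` {x @ y}),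
     one = word_rel R `` {[]}\<rparr>"

lemma equiv_word_rel: "equiv UNIV (word_rel R)"
proof (rule equivI)
  show "refl_on UNIV (word_rel R)" by (auto simp: word_rel_def refl_on_def word_eq.refl)
  show "sym (word_rel R)" by (auto simp: word_rel_def sym_def dest: word_eq.sym)
  show "trans (word_rel R)" unfolding word_rel_def trans_def by (blast dest: word_eq.trans)
qed simp

lemma word_eq_context: "word_eq R u v \<Longrightarrow> word_eq R (p @ u @ q) (p @ v @ q)"
proof (induction rule: word_eq.induct)
  case (refl u)
  show ?case by (rule word_eq.refl)
next
  case (sym u v)
  then show ?case by (simp add: word_eq.sym)
next
  case (trans u v w)
  then show ?case by (blast dest: word_eq.trans)
next
  case (cancel p' x q')
  show ?case using word_eq.cancel[of R "p @ p'" x "q' @ q"] by simp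
next
  case (relation u v p' q')
  then show ?case using word_eq.relation[of u v R "p @ p'" "q' @ q"] by simp
qed

lemma word_eq_append:
  assumes "word_eq R u u'" "word_eq R v v'"
  shows "word_eq R (u @ v) (u' @ v')"
proof (rule word_eq.trans)
  show "word_eq R (u @ v) (u' @ v)" using word_eq_context[OF assms(1), of "[]" v] by simp
  show "word_eq R (u' @ v) (u' @ v')" using word_eq_context[OF assms(2), of u' "[]"] by simp
qed

lemma word_class_eq_iff: "word_rel R `` {u} = word_rel R `` {v} \<longleftrightarrow> word_eq R u v"
  using eq_equiv_class_iff[OF equiv_word_rel, of u v R] by (simp add: word_rel_def)

lemma presented_group_carrier:
  "carrier (presented_group R) = range (\<lambda>u. word_rel R `` {u})"
  by (auto simp: presented_group_def quotient_def)

lemma presented_group_one: "\<one>\<^bsub>presented_group R\<^esub> = word_rel R `` {[]}"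
  by (simp add: presented_group_def)

lemma presented_group_mult:
  "word_rel R `` {u} \<otimes>\<^bsub>presented_group R\<^esub> word_rel R `` {v} = word_rel R `` {u @ v}"
proof -
  have "word_rel R `` {x @ y} = word_rel R `` {u @ v}"
    if "x \<in> word_rel R `` {u}" "y \<in> word_rel R `` {v}" for x y
    using that unfolding word_class_eq_iff
    by (simp add: word_rel_def word_eq_append word_eq.sym)
  moreover have "u \<in> word_rel R `` {u}" "v \<in> word_rel R `` {v}"
    by (auto simp: word_rel_def word_eq.refl)
  ultimately have "(\<Union>x\<in>word_rel R `` {u}. \<Union>y\<in>word_rel R `` {v}. word_rel R `` {x @ y}) =
      word_rel R `` {u @ v}"
    by blast
  then show ?thesis
    by (simp add: presented_group_def)
qed

lemma word_eq_inverse: "word_eq R (rev (map inv_letter u) @ u) []"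
proof (induction u)
  case Nil
  show ?case by (simp add: word_eq.refl)
next
  case (Cons x u)
  have "inv_letter (inv_letter x) = x" by (cases x) auto
  with word_eq.cancel[of R "rev (map inv_letter u)" "inv_letter x" u]
  have "word_eq R (rev (map inv_letter (x # u)) @ x # u) (rev (map inv_letter u) @ u)" by simp
  from word_eq.trans[OF this Cons] show ?case .
qed

lemma group_presented_group: "group (presented_group R)"
proof (rule groupI)
  fix X assume "X \<in> carrier (presented_group R)"
  then obtain u where u: "X = word_rel R `` {u}" by (auto simp: presented_group_carrier)
  show "\<exists>Y\<in>carrier (presented_group R). Y \<otimes>\<^bsub>presented_group R\<^esub> X = \<one>\<^bsub>presented_group R\<^esub>"
    by (rule bexI[of _ "word_rel R `` {rev (map inv_letter u)}"])
      (auto simp: u presented_group_carrier presented_group_mult presented_group_one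
        word_class_eq_iff word_eq_inverse)
qed (auto simp: presented_group_carrier presented_group_mult presented_group_one)

datatype gen = a | b

definition V8n :: "nat \<Rightarrow> gen word set monoid" where
  "V8n n = presented_group
    {(replicate (2 * n) (Gen a), []),
     (replicate 4 (Gen b), []),
     ([Inv b, Gen a, Inv b], [Gen b, Gen a, Gen b]),
     ([Gen b, Gen a, Gen b], [Inv a])}"

definition SD8n :: "nat \<Rightarrow> gen word set monoid" where
  "SD8n n = presented_group
    {(replicate (4 * n) (Gen a), []),
     (replicate 2 (Gen b), []),
     ([Gen b, Gen a, Gen b], replicate (2 * n - 1) (Gen a))}"

hide_const (open) a b

text \<open>Edges are two-element sets of vertices.\<close>

record 'v graph =
  vertices :: "'v set"
  edges :: "'v set set"

definition simple_graph :: "'v graph \<Rightarrow> bool" where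
  "simple_graph \<G> \<longleftrightarrow> finite (vertices \<G>) \<and> (\<forall>e\<in>edges \<G>. e \<subseteq> vertices \<G> \<and> card e = 2)"

definition vertex_degree :: "'v graph \<Rightarrow> 'v \<Rightarrow> nat" where
  "vertex_degree \<G> v = card {e \<in> edges \<G>. v \<in> e}"

text \<open>Matrices are indexed by \<open>0, \<dots>, |v(\<G>)| - 1\<close>, so an arbitrary enumeration of the
  vertices is fixed. Another enumeration conjugates the matrices below by a permutation matrix
  and leaves their spectra unchanged.\<close>

definition vertex_list :: "'v graph \<Rightarrow> 'v list" where
  "vertex_list \<G> = (SOME vs. distinct vs \<and> set vs = vertices \<G>)"

definition adjacency_matrix :: "'v graph \<Rightarrow> real mat" where
  "adjacency_matrix \<G> = (let vs = vertex_list \<G>; N = card (vertices \<G>) in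
    mat N N (\<lambda>(i, j). if {vs ! i, vs ! j} \<in> edges \<G> then 1 else 0))"

definition degree_matrix :: "'v graph \<Rightarrow> real mat" where
  "degree_matrix \<G> = (let vs = vertex_list \<G>; N = card (vertices \<G>) in
    mat N N (\<lambda>(i, j). if i = j then real (vertex_degree \<G> (vs ! i)) else 0))"

definition laplacian_matrix :: "'v graph \<Rightarrow> real mat" where
  "laplacian_matrix \<G> = degree_matrix \<G> - adjacency_matrix \<G>"

text \<open>The eigenvalues with multiplicity. This is only applied to real symmetric matrices, whose
  characteristic polynomials split over the reals and whose algebraic and geometric
  multiplicities agree.\<close>

definition eigenvalues :: "real mat \<Rightarrow> real multiset" where
  "eigenvalues A = proots (char_poly A)"

lemma in_eigenvalues_iff:
  assumes "A \<in> carrier_mat n n"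
  shows "x \<in># eigenvalues A \<longleftrightarrow> eigenvalue A x"
proof -
  have "char_poly A \<noteq> 0"
    using degree_monic_char_poly[OF assms] by auto
  then show ?thesis
    by (simp add: eigenvalues_def eigenvalue_root_char_poly[OF assms])
qed

definition energy :: "'v graph \<Rightarrow> real" where
  "energy \<G> = (\<Sum>x\<in>#eigenvalues (adjacency_matrix \<G>). \<bar>x\<bar>)"

definition laplacian_energy :: "'v graph \<Rightarrow> real" where
  "laplacian_energy \<G> = (\<Sum>\<mu>\<in>#eigenvalues (laplacian_matrix \<G>).
    \<bar>\<mu> - 2 * real (card (edges \<G>)) / real (card (vertices \<G>))\<bar>)"

definition center :: "('a, 'b) monoid_scheme \<Rightarrow> 'a set" where
  "center G = {z \<in> carrier G. \<forall>x\<in>carrier G. z \<otimes>\<^bsub>G\<^esub> x = x \<otimes>\<^bsub>G\<^esub> z}"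

definition noncommuting_graph :: "('a, 'b) monoid_scheme \<Rightarrow> 'a graph" where
  "noncommuting_graph G =
    \<lparr>vertices = carrier G - center G,
     edges = {{x, y} | x y. x \<in> carrier G - center G \<and> y \<in> carrier G - center G \<and>
       x \<otimes>\<^bsub>G\<^esub> y \<noteq> y \<otimes>\<^bsub>G\<^esub> x}\<rparr>"

lemma simple_graph_noncommuting_graph:
  assumes "finite (carrier G)"
  shows "simple_graph (noncommuting_graph G)"
proof -
  have "card {x, y} = 2" if "x \<otimes>\<^bsub>G\<^esub> y \<noteq> y \<otimes>\<^bsub>G\<^esub> x" for x y
    using that by (cases "x = y") auto
  then show ?thesis
    using assms by (auto simp: simple_graph_def noncommuting_graph_def)
qed

end

theory Submission
  imports Defs "HOL-Algebra.Coset"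
begin

text \<open>Both groups have an abelian subgroup \<open>A\<close> of index at most two: the one generated by \<open>a\<close> and \<open>b\<^sup>2\<close>
  (\<open>twisted_dihedral.carrier_eq\<close>). This alone implies the inequality, for every finite group.

  If the group is abelian, the graph is empty. Otherwise, let \<open>Z\<close> be the center, \<open>c\<close> its order and
  \<open>k c\<close> the order of \<open>A\<close>. An element of \<open>A\<close> that commutes with some element outside \<open>A\<close> is central,
  because \<open>A\<close> and any outside element generate the group. Hence the centralizer of a non-central
  element of \<open>A\<close> is \<open>A\<close>, and the centralizer of an outside element \<open>x\<close> is the union of \<open>Z\<close> and \<open>Z x\<close>. So
  commuting is an equivalence relation on the non-central elements, and the non-commuting graph is
  complete multipartite with one part \<open>A - Z\<close> of size \<open>c (k - 1)\<close> and \<open>k\<close> parts of size \<open>c\<close>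
  (\<open>noncommuting_graph_multipartite\<close>, \<open>part_sizes\<close>).

  The spectra of a complete multipartite graph are computed from Sylvester's identity
  \<open>det (1 + X Y) = det (1 + Y X)\<close>, which holds for rectangular factors and so passes from vertices to
  parts for an arbitrary enumeration of the vertices (\<open>det_diagonal_minus_off_blocks\<close>,
  \<open>energy_multipartite\<close>, \<open>laplacian_energy_multipartite\<close>). The two energies become explicit functions
  of \<open>c\<close> and \<open>k\<close>; they coincide for \<open>k = 2\<close>, when the graph is regular, and in general a tangent
  estimate of a square root at \<open>k = 2\<close> leaves the non-negative polynomial \<open>(k - 2)\<^sup>2 (6 k - 2)\<close>
  (\<open>multipartite_energy_inequality\<close>).\<close>

section \<open>Determinants of block-constant matrices\<close>

text \<open>Sylvester's determinant identity. Both sides are the determinant of the block matrix with rows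
  \<open>(1, - X)\<close> and \<open>(Y, 1)\<close>: multiplying it by the unipotent block matrix with rows \<open>(1, X)\<close> and
  \<open>(0, 1)\<close>, on the right or on the left, clears the block \<open>- X\<close> and leaves one of the two sums on
  the diagonal.\<close>

lemma det_one_plus_mult_commute:
  fixes X Y :: "'a :: idom mat"
  assumes X: "X \<in> carrier_mat n m" and Y: "Y \<in> carrier_mat m n"
  shows "det (1\<^sub>m n + X * Y) = det (1\<^sub>m m + Y * X)"
proof -
  let ?M = "four_block_mat (1\<^sub>m n) (- X) Y (1\<^sub>m m)"
  let ?U = "four_block_mat (1\<^sub>m n) X (0\<^sub>m m n) (1\<^sub>m m)"
  have M: "?M \<in> carrier_mat (n + m) (n + m)" and U: "?U \<in> carrier_mat (n + m) (n + m)"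
    using X Y by auto
  have detU: "det ?U = 1"
    by (subst det_four_block_mat_lower_left_zero) (use X in auto)
  have "?M * ?U = four_block_mat (1\<^sub>m n) (0\<^sub>m n m) Y (1\<^sub>m m + Y * X)"
    by (subst mult_four_block_mat) (use X Y in \<open>auto intro!: cong_four_block_mat simp: comm_add_mat[of _ m m]\<close>)
  then have "det ?M * det ?U = det (1\<^sub>m m + Y * X)"
    using X Y by (subst det_mult[OF M U, symmetric])
      (simp add: det_four_block_mat_upper_right_zero[of _ n _ m])
  moreover have "?U * ?M = four_block_mat (1\<^sub>m n + X * Y) (0\<^sub>m n m) Y (1\<^sub>m m)"
    by (subst mult_four_block_mat) (use X Y in \<open>auto intro!: cong_four_block_mat\<close>)
  then have "det ?U * det ?M = det (1\<^sub>m n + X * Y)"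
    using X Y by (subst det_mult[OF U M, symmetric])
      (simp add: det_four_block_mat_upper_right_zero[of _ n _ m])
  ultimately show ?thesis
    using detU by simp
qed

lemma det_diagonal:
  "det (mat n n (\<lambda>(i, j). if i = j then d i else 0)) = (\<Prod>i<n. d i)"
  by (subst det_upper_triangular[of _ n])
    (auto simp: diag_mat_def prod.list_conv_set_nth atLeast0LessThan upper_triangular_def intro!: prod.cong)

text \<open>The index set is partitioned by \<open>f\<close>; the matrix is \<open>\<delta>\<close> on the diagonal plus \<open>\<epsilon>\<close> on every diagonal
  block of the partition. The blocks factor through the membership matrix of indices in parts, so
  Sylvester's identity replaces the matrix by a diagonal one indexed by the parts. No block has to
  be contiguous, so no reordering of the indices is involved.\<close>

lemma det_diagonal_plus_blocks:
  fixes \<delta> :: "'p \<Rightarrow> 'a :: field" and f :: "nat \<Rightarrow> 'p" and n :: nat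
  defines "m \<equiv> \<lambda>P. card {i \<in> {..<n}. f i = P}"
  assumes \<delta>: "\<And>P. P \<in> f ` {..<n} \<Longrightarrow> \<delta> P \<noteq> 0"
  shows "det (mat n n (\<lambda>(i, j). (if i = j then \<delta> (f i) else 0) + (if f i = f j then \<epsilon> else 0))) =
    (\<Prod>P\<in>f ` {..<n}. \<delta> P ^ (m P - 1) * (\<delta> P + \<epsilon> * of_nat (m P)))"
proof -
  define K where "K = card (f ` {..<n})"
  obtain e where e: "bij_betw e {..<K} (f ` {..<n})"
    unfolding K_def using ex_bij_betw_nat_finite[of "f ` {..<n}"] by (auto simp: atLeast0LessThan)
  define D where "D = mat n n (\<lambda>(i, j). if i = j then \<delta> (f i) else 0)"
  \<comment> \<open>With these factors \<open>X * Y\<close> is the block part divided by \<open>\<delta>\<close>, and \<open>Y * X\<close> is diagonal because the parts are disjoint.\<close>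
  define X where "X = mat n K (\<lambda>(i, k). if f i = e k then \<epsilon> / \<delta> (e k) else 0)"
  define Y where "Y = mat K n (\<lambda>(k, j). if f j = e k then 1 else 0 :: 'a)"
  have inj: "e k = e l \<longleftrightarrow> k = l" if "k < K" "l < K" for k l
    using e that by (auto simp: bij_betw_def inj_on_def)
  have index: "\<exists>k<K. e k = f i" if "i < n" for i
    using e that unfolding bij_betw_def by (metis imageE imageI lessThan_iff)
  have XY: "(X * Y) $$ (i, j) = (if f i = f j then \<epsilon> / \<delta> (f i) else 0)" if "i < n" "j < n" for i j
  proof -
    obtain k where k: "k < K" "e k = f i" using index[OF \<open>i < n\<close>] by blast
    have "(X * Y) $$ (i, j) =
        (\<Sum>l = 0..<K. (if f i = e l then \<epsilon> / \<delta> (e l) else 0) * (if f j = e l then 1 else 0))"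
      using that by (simp add: X_def Y_def scalar_prod_def)
    also have "\<dots> = (\<Sum>l = 0..<K. if l = k then (if f i = f j then \<epsilon> / \<delta> (f i) else 0) else 0)"
      using k inj by (intro sum.cong) auto
    finally show ?thesis using k by simp
  qed
  have YX: "(Y * X) $$ (k, l) = (if k = l then \<epsilon> * of_nat (m (e k)) / \<delta> (e k) else 0)"
    if "k < K" "l < K" for k l
  proof -
    have "(Y * X) $$ (k, l) =
        (\<Sum>i = 0..<n. (if f i = e k then 1 else 0) * (if f i = e l then \<epsilon> / \<delta> (e l) else 0))"
      using that by (simp add: X_def Y_def scalar_prod_def)
    also have "\<dots> = (\<Sum>i\<in>{..<n}. if f i = e k then (if k = l then \<epsilon> / \<delta> (e k) else 0) else 0)"
      using that inj by (intro sum.cong) auto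
    also have "\<dots> = (\<Sum>i\<in>{i \<in> {..<n}. f i = e k}. if k = l then \<epsilon> / \<delta> (e k) else 0)"
      by (rule sum.inter_filter[symmetric]) simp
    finally show ?thesis by (simp add: m_def)
  qed
  have "mat n n (\<lambda>(i, j). (if i = j then \<delta> (f i) else 0) + (if f i = f j then \<epsilon> else 0)) =
      D * (1\<^sub>m n + X * Y)" (is "?M = _")
  proof (rule eq_matI)
    fix i j assume "i < dim_row (D * (1\<^sub>m n + X * Y))" "j < dim_col (D * (1\<^sub>m n + X * Y))"
    then have ij: "i < n" "j < n" by (auto simp: D_def X_def Y_def)
    have W: "1\<^sub>m n + X * Y \<in> carrier_mat n n"
      by (auto simp: X_def Y_def)
    have "(D * (1\<^sub>m n + X * Y)) $$ (i, j) =
        (\<Sum>l = 0..<n. (if i = l then \<delta> (f i) else 0) * (1\<^sub>m n + X * Y) $$ (l, j))"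
      using ij W by (simp add: D_def scalar_prod_def del: index_add_mat)
    also have "\<dots> = (\<Sum>l = 0..<n. if l = i then \<delta> (f i) * (1\<^sub>m n + X * Y) $$ (i, j) else 0)"
      by (intro sum.cong) auto
    also have "\<dots> = \<delta> (f i) * (1\<^sub>m n + X * Y) $$ (i, j)"
      using ij by simp
    also have "(1\<^sub>m n + X * Y) $$ (i, j) =
        (if i = j then 1 else 0) + (if f i = f j then \<epsilon> / \<delta> (f i) else 0)"
      unfolding XY[OF ij, symmetric] using ij by (subst index_add_mat) (auto simp: X_def Y_def)
    finally show "?M $$ (i, j) = (D * (1\<^sub>m n + X * Y)) $$ (i, j)"
      using ij \<delta>[of "f i"] by (auto simp: field_simps)
  qed (auto simp: D_def X_def Y_def)
  then have "det ?M = det D * det (1\<^sub>m n + X * Y)"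
    by (simp only:) (rule det_mult[of _ n], auto simp: D_def X_def Y_def)
  also have "det (1\<^sub>m n + X * Y) = det (1\<^sub>m K + Y * X)"
    by (rule det_one_plus_mult_commute) (auto simp: X_def Y_def)
  also have "1\<^sub>m K + Y * X =
      mat K K (\<lambda>(k, l). if k = l then 1 + \<epsilon> * of_nat (m (e k)) / \<delta> (e k) else 0)" (is "_ = ?D")
  proof (rule eq_matI)
    fix k l assume "k < dim_row ?D" "l < dim_col ?D"
    then have kl: "k < K" "l < K" by auto
    then have "(1\<^sub>m K + Y * X) $$ (k, l) = (if k = l then 1 else 0) + (Y * X) $$ (k, l)"
      by (subst index_add_mat) (auto simp: X_def Y_def)
    then show "(1\<^sub>m K + Y * X) $$ (k, l) = ?D $$ (k, l)"
      unfolding YX[OF kl] using kl by simp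
  qed (auto simp: X_def Y_def)
  also have "det \<dots> = (\<Prod>k<K. 1 + \<epsilon> * of_nat (m (e k)) / \<delta> (e k))"
    by (rule det_diagonal)
  also have "\<dots> = (\<Prod>P\<in>f ` {..<n}. 1 + \<epsilon> * of_nat (m P) / \<delta> P)"
    by (rule prod.reindex_bij_betw[OF e])
  also have "det D = (\<Prod>P\<in>f ` {..<n}. \<delta> P ^ m P)"
    unfolding D_def det_diagonal by (subst prod.image_gen[of _ _ f]) (auto simp: m_def intro!: prod.cong)
  also have "\<dots> * (\<Prod>P\<in>f ` {..<n}. 1 + \<epsilon> * of_nat (m P) / \<delta> P) =
      (\<Prod>P\<in>f ` {..<n}. \<delta> P ^ (m P - 1) * (\<delta> P + \<epsilon> * of_nat (m P)))"
  proof (unfold prod.distrib[symmetric], rule prod.cong)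
    fix P assume P: "P \<in> f ` {..<n}"
    then have "m P > 0" by (auto simp: m_def card_gt_0_iff)
    then have "\<delta> P ^ m P = \<delta> P ^ (m P - 1) * \<delta> P"
      by (metis power_minus_mult)
    then show "\<delta> P ^ m P * (1 + \<epsilon> * of_nat (m P) / \<delta> P) =
        \<delta> P ^ (m P - 1) * (\<delta> P + \<epsilon> * of_nat (m P))"
      using \<delta>[OF P] by (simp add: field_simps)
  qed simp
  finally show ?thesis .
qed

text \<open>Putting \<open>- \<epsilon>\<close> outside the blocks instead of \<open>\<epsilon>\<close> inside them subtracts a constant matrix, which has
  rank one. The vector with entries \<open>1 / (\<delta> + \<epsilon> m)\<close> is mapped to the all-ones vector by the block
  matrix, so Sylvester's identity reduces the correction to a scalar factor.\<close>

lemma det_diagonal_minus_off_blocks: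
  fixes \<delta> :: "'p \<Rightarrow> 'a :: field" and f :: "nat \<Rightarrow> 'p" and n :: nat
  defines "m \<equiv> \<lambda>P. card {i \<in> {..<n}. f i = P}"
  assumes \<delta>: "\<And>P. P \<in> f ` {..<n} \<Longrightarrow> \<delta> P \<noteq> 0"
    and \<delta>m: "\<And>P. P \<in> f ` {..<n} \<Longrightarrow> \<delta> P + \<epsilon> * of_nat (m P) \<noteq> 0"
  shows "det (mat n n (\<lambda>(i, j). (if i = j then \<delta> (f i) else 0) - (if f i = f j then 0 else \<epsilon>))) =
    (\<Prod>P\<in>f ` {..<n}. \<delta> P ^ (m P - 1) * (\<delta> P + \<epsilon> * of_nat (m P))) *
    (1 - \<epsilon> * (\<Sum>P\<in>f ` {..<n}. of_nat (m P) / (\<delta> P + \<epsilon> * of_nat (m P))))"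
proof -
  let ?M = "mat n n (\<lambda>(i, j). (if i = j then \<delta> (f i) else 0) + (if f i = f j then \<epsilon> else 0))"
  let ?\<gamma> = "\<lambda>P. \<delta> P + \<epsilon> * of_nat (m P)"
  define X where "X = mat n 1 (\<lambda>(i, k :: nat). - \<epsilon> / ?\<gamma> (f i))"
  define Y where "Y = mat 1 n (\<lambda>(k :: nat, j :: nat). 1 :: 'a)"
  have MX: "?M * X = mat n 1 (\<lambda>_. - \<epsilon>)"
  proof (rule eq_matI)
    fix i j assume "i < dim_row (mat n 1 (\<lambda>_. - \<epsilon>))" "j < dim_col (mat n 1 (\<lambda>_. - \<epsilon>))"
    then have ij: "i < n" "j = 0" by auto
    let ?v = "- \<epsilon> / ?\<gamma> (f i)"
    have "(?M * X) $$ (i, j) =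
        (\<Sum>l\<in>{..<n}. ((if i = l then \<delta> (f i) else 0) + (if f i = f l then \<epsilon> else 0)) * (- \<epsilon> / ?\<gamma> (f l)))"
      using ij by (simp add: X_def scalar_prod_def atLeast0LessThan)
    also have "\<dots> = (\<Sum>l\<in>{..<n}. (if l = i then \<delta> (f i) * ?v else 0) + (if f l = f i then \<epsilon> * ?v else 0))"
      by (rule sum.cong) (auto simp: distrib_right add_divide_distrib)
    also have "\<dots> = \<delta> (f i) * ?v + (\<Sum>l\<in>{..<n}. if f l = f i then \<epsilon> * ?v else 0)"
      using ij by (simp add: sum.distrib)
    also have "(\<Sum>l\<in>{..<n}. if f l = f i then \<epsilon> * ?v else 0) = of_nat (m (f i)) * (\<epsilon> * ?v)"
      by (subst sum.inter_filter[symmetric]) (auto simp: m_def)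
    also have "\<delta> (f i) * ?v + of_nat (m (f i)) * (\<epsilon> * ?v) = ?\<gamma> (f i) * ?v"
      by (simp only: distrib_right mult.assoc mult.commute mult.left_commute)
    also have "\<dots> = - \<epsilon>"
      using \<delta>m[of "f i"] ij by simp
    finally show "(?M * X) $$ (i, j) = mat n 1 (\<lambda>_. - \<epsilon>) $$ (i, j)"
      using ij by simp
  qed (auto simp: X_def)
  have "mat n n (\<lambda>(i, j). (if i = j then \<delta> (f i) else 0) - (if f i = f j then 0 else \<epsilon>)) =
      ?M + ?M * X * Y" (is "?R = _")
    unfolding MX by (rule eq_matI) (auto simp: Y_def scalar_prod_def)
  also have "\<dots> = ?M * (1\<^sub>m n + X * Y)"
  proof -
    have c: "?M \<in> carrier_mat n n" "X \<in> carrier_mat n 1" "Y \<in> carrier_mat 1 n"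
      by (auto simp: X_def Y_def)
    then show ?thesis
      by (simp add: mult_add_distrib_mat[of _ n n _ n] assoc_mult_mat[OF c])
  qed
  finally have "det ?R = det ?M * det (1\<^sub>m n + X * Y)"
    by (simp only:) (rule det_mult[of _ n], auto simp: X_def Y_def)
  also have "det (1\<^sub>m n + X * Y) = det (1\<^sub>m 1 + Y * X)"
    by (rule det_one_plus_mult_commute) (auto simp: X_def Y_def)
  also have "\<dots> = 1 + (\<Sum>i\<in>{..<n}. - \<epsilon> / ?\<gamma> (f i))"
    by (subst det_single) (auto simp: X_def Y_def scalar_prod_def atLeast0LessThan)
  also have "(\<Sum>i\<in>{..<n}. - \<epsilon> / ?\<gamma> (f i)) = (\<Sum>P\<in>f ` {..<n}. of_nat (m P) * (- \<epsilon> / ?\<gamma> P))"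
    by (subst sum.image_gen[of _ _ f]) (auto simp: m_def intro!: sum.cong)
  also have "1 + \<dots> = 1 - \<epsilon> * (\<Sum>P\<in>f ` {..<n}. of_nat (m P) / ?\<gamma> P)"
    by (simp add: sum_distrib_left sum_negf mult.commute)
  also have "det ?M = (\<Prod>P\<in>f ` {..<n}. \<delta> P ^ (m P - 1) * ?\<gamma> P)"
    unfolding m_def by (rule det_diagonal_plus_blocks[OF \<delta>])
  finally show ?thesis .
qed

section \<open>Complete multipartite graphs\<close>

text \<open>Handshaking: every edge contains two vertices.\<close>

lemma sum_vertex_degree:
  assumes "simple_graph \<G>"
  shows "(\<Sum>v\<in>vertices \<G>. vertex_degree \<G> v) = 2 * card (edges \<G>)"
proof -
  have V: "finite (vertices \<G>)" and E: "\<And>e. e \<in> edges \<G> \<Longrightarrow> e \<subseteq> vertices \<G> \<and> card e = 2"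
    using assms by (auto simp: simple_graph_def)
  have finE: "finite (edges \<G>)"
    by (rule finite_subset[of _ "Pow (vertices \<G>)"]) (use V E in auto)
  have "{v \<in> vertices \<G>. v \<in> e} = e" if "e \<in> edges \<G>" for e
    using E[OF that] by auto
  then show ?thesis
    unfolding vertex_degree_def using V finE E
    by (intro sum_multicount_gen[THEN HOL.trans, of _ _ _ "\<lambda>_. 2"]) auto
qed

definition multipartite_graph :: "'v set \<Rightarrow> ('v \<Rightarrow> 'p) \<Rightarrow> 'v graph" where
  "multipartite_graph V part =
    \<lparr>vertices = V, edges = {{x, y} | x y. x \<in> V \<and> y \<in> V \<and> part x \<noteq> part y}\<rparr>"

lemma simple_graph_multipartite_graph: "finite V \<Longrightarrow> simple_graph (multipartite_graph V part)"
  by (auto simp: simple_graph_def multipartite_graph_def card_insert_if)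

lemma edge_multipartite_graph_iff:
  "{x, y} \<in> edges (multipartite_graph V part) \<longleftrightarrow> x \<in> V \<and> y \<in> V \<and> part x \<noteq> part y"
  by (auto simp: multipartite_graph_def doubleton_eq_iff)

lemma vertex_degree_multipartite_graph:
  assumes "finite V" "v \<in> V"
  shows "vertex_degree (multipartite_graph V part) v + card {w \<in> V. part w = part v} = card V"
proof -
  have "{e \<in> edges (multipartite_graph V part). v \<in> e} = (\<lambda>w. {v, w}) ` {w \<in> V. part w \<noteq> part v}"
    using assms(2) by (auto simp: multipartite_graph_def)
  moreover have "inj_on (\<lambda>w. {v, w}) {w \<in> V. part w \<noteq> part v}"
    by (auto simp: inj_on_def doubleton_eq_iff)
  ultimately have "vertex_degree (multipartite_graph V part) v = card {w \<in> V. part w \<noteq> part v}"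
    by (simp add: vertex_degree_def card_image)
  moreover have "card {w \<in> V. part w \<noteq> part v} + card {w \<in> V. part w = part v} = card V"
    using assms(1) by (subst card_Un_disjoint[symmetric]) (auto intro!: arg_cong[of _ _ card])
  ultimately show ?thesis by simp
qed

lemma vertex_list:
  assumes "finite (vertices \<G>)"
  shows "distinct (vertex_list \<G>)" "set (vertex_list \<G>) = vertices \<G>"
    "length (vertex_list \<G>) = card (vertices \<G>)"
proof -
  have "\<exists>vs. distinct vs \<and> set vs = vertices \<G>"
    using finite_distinct_list[OF assms] by blast
  then have "distinct (vertex_list \<G>) \<and> set (vertex_list \<G>) = vertices \<G>"
    unfolding vertex_list_def by (rule someI_ex)
  then show "distinct (vertex_list \<G>)" "set (vertex_list \<G>) = vertices \<G>"
    "length (vertex_list \<G>) = card (vertices \<G>)"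
    by (auto simp: distinct_card[symmetric])
qed

text \<open>The enumeration of the vertices enters the determinants only through the sizes of the index sets of
  the parts, and these are the sizes of the parts themselves.\<close>

lemma card_index_fiber:
  assumes "distinct vs"
  shows "card {i \<in> {..<length vs}. g (vs ! i) = P} = card {v \<in> set vs. g v = P}"
proof (rule bij_betw_same_card[of "(!) vs"])
  have "inj_on ((!) vs) {i \<in> {..<length vs}. g (vs ! i) = P}"
    using assms by (auto simp: inj_on_def nth_eq_iff_index_eq)
  then show "bij_betw ((!) vs) {i \<in> {..<length vs}. g (vs ! i) = P} {v \<in> set vs. g v = P}"
    by (auto simp: bij_betw_def in_set_conv_nth)
qed

lemma image_index: "(\<lambda>i. g (vs ! i)) ` {..<length vs} = g ` set vs"
  by (auto simp: set_conv_nth image_iff)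

section \<open>Spectra of complete multipartite graphs\<close>

text \<open>The matrix \<open>x 1 - A\<close> has \<open>x\<close> on the diagonal and \<open>- 1\<close> between different parts. Positive \<open>x\<close> suffice
  to determine the characteristic polynomial and keep all denominators away from zero.\<close>

lemma poly_char_poly_adjacency_multipartite:
  fixes part :: "'v \<Rightarrow> 'p" and V :: "'v set"
  defines "m \<equiv> \<lambda>P. card {v \<in> V. part v = P}"
  assumes V: "finite V" and x: "x > 0"
  shows "poly (char_poly (adjacency_matrix (multipartite_graph V part))) x =
    (\<Prod>P\<in>part ` V. x ^ (m P - 1) * (x + real (m P))) *
    (1 - (\<Sum>P\<in>part ` V. real (m P) / (x + real (m P))))"
proof -
  let ?G = "multipartite_graph V part" and ?N = "card V"
  define vs where "vs = vertex_list ?G"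
  define f where "f = (\<lambda>i. part (vs ! i))"
  have vs: "distinct vs" "set vs = V" "length vs = ?N"
    using vertex_list[of ?G] V by (auto simp: vs_def multipartite_graph_def)
  have f: "f ` {..<?N} = part ` V" "card {i \<in> {..<?N}. f i = P} = m P" for P
    using image_index[of part vs] card_index_fiber[OF vs(1), of part P] vs
    by (simp_all add: f_def m_def)
  have V_nth: "vs ! i \<in> V" if "i < ?N" for i
    using that vs by (metis nth_mem)
  have "poly (char_poly (adjacency_matrix ?G)) x =
      det (mat ?N ?N (\<lambda>(i, j). (if i = j then x else 0) - (if f i = f j then 0 else 1)))"
    unfolding char_poly_def using V_nth
    by (intro poly_det_cong[of _ ?N])
      (auto simp: char_poly_matrix_def adjacency_matrix_def edge_multipartite_graph_iff Let_def
        vs_def[symmetric] f_def, auto simp: multipartite_graph_def)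
  also have "\<dots> = (\<Prod>P\<in>part ` V. x ^ (m P - 1) * (x + real (m P))) *
    (1 - (\<Sum>P\<in>part ` V. real (m P) / (x + real (m P))))"
    using det_diagonal_minus_off_blocks[of f ?N "\<lambda>_. x" 1, unfolded f] x
    by (simp add: add_pos_nonneg less_imp_neq[THEN not_sym])
  finally show ?thesis .
qed

text \<open>The matrix \<open>x 1 - L\<close> has \<open>1\<close> between different parts, and its diagonal is constant on each part
  because a vertex of a part of size \<open>m\<close> has degree \<open>card V - m\<close>. Here every part contributes the
  same denominator \<open>x - card V\<close>, so the scalar factor collapses.\<close>

lemma poly_char_poly_laplacian_multipartite:
  fixes part :: "'v \<Rightarrow> 'p" and V :: "'v set"
  defines "m \<equiv> \<lambda>P. card {v \<in> V. part v = P}"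
  assumes V: "finite V" and x: "x > real (card V)"
  shows "poly (char_poly (laplacian_matrix (multipartite_graph V part))) x =
    (\<Prod>P\<in>part ` V. (x - (real (card V) - real (m P))) ^ (m P - 1) * (x - real (card V))) *
    (1 + real (card V) / (x - real (card V)))"
proof -
  let ?G = "multipartite_graph V part" and ?N = "card V"
  define vs where "vs = vertex_list ?G"
  define f where "f = (\<lambda>i. part (vs ! i))"
  let ?\<delta> = "\<lambda>P. x - (real ?N - real (m P))"
  have vs: "distinct vs" "set vs = V" "length vs = ?N"
    using vertex_list[of ?G] V by (auto simp: vs_def multipartite_graph_def)
  have f: "f ` {..<?N} = part ` V" "card {i \<in> {..<?N}. f i = P} = m P" for P
    using image_index[of part vs] card_index_fiber[OF vs(1), of part P] vs
    by (simp_all add: f_def m_def)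
  have V_nth: "vs ! i \<in> V" if "i < ?N" for i
    using that vs by (metis nth_mem)
  have degree: "real (vertex_degree ?G (vs ! i)) = real ?N - real (m (f i))" if "i < ?N" for i
    using vertex_degree_multipartite_graph[OF V V_nth[OF that], of part] by (simp add: m_def f_def)
  have "poly (char_poly (laplacian_matrix ?G)) x =
      det (mat ?N ?N (\<lambda>(i, j). (if i = j then ?\<delta> (f i) else 0) - (if f i = f j then 0 else - 1)))"
    unfolding char_poly_def using V_nth degree
    by (intro poly_det_cong[of _ ?N])
      (auto simp: char_poly_matrix_def laplacian_matrix_def degree_matrix_def adjacency_matrix_def
        edge_multipartite_graph_iff Let_def vs_def[symmetric] f_def, auto simp: multipartite_graph_def)
  also have "\<dots> = (\<Prod>P\<in>part ` V. ?\<delta> P ^ (m P - 1) * (x - real ?N)) *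
    (1 + (\<Sum>P\<in>part ` V. real (m P) / (x - real ?N)))"
  proof -
    have "?\<delta> P \<noteq> 0" for P
      using x of_nat_0_le_iff[of "m P", where 'a = real] by linarith
    then show ?thesis
      using det_diagonal_minus_off_blocks[of f ?N ?\<delta> "- 1", unfolded f] x
      by simp
  qed
  also have "(\<Sum>P\<in>part ` V. real (m P) / (x - real ?N)) = real ?N / (x - real ?N)"
  proof -
    have "?N = (\<Sum>P\<in>part ` V. m P)"
      using sum.image_gen[OF V, of "\<lambda>_. 1 :: nat" part] by (simp add: m_def)
    then show ?thesis by (simp add: sum_divide_distrib[symmetric])
  qed
  finally show ?thesis .
qed

lemma poly_eq_if_eq_above:
  fixes p q :: "real poly"
  assumes "\<And>x. x > B \<Longrightarrow> poly p x = poly q x"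
  shows "p = q"
proof (rule ccontr)
  assume "p \<noteq> q"
  then have "finite {x. poly (p - q) x = 0}"
    by (intro poly_roots_finite) simp
  moreover have "{B<..} \<subseteq> {x. poly (p - q) x = 0}"
    using assms by auto
  ultimately show False
    using infinite_Ioi finite_subset by blast
qed

lemma proots_linear_power_mult:
  fixes q :: "'a :: idom poly"
  assumes "q \<noteq> 0"
  shows "proots ([:a, 1:] ^ n * q) = replicate_mset n (- a) + proots q"
  using assms by (subst proots_mult) (simp_all add: proots_power repeat_mset_replicate_mset)

text \<open>One part of size \<open>p\<close> and \<open>k\<close> parts of size \<open>c\<close>. Apart from \<open>0\<close> and \<open>- c\<close> (the latter \<open>k - 1\<close> times),
  the eigenvalues are the two roots of \<open>x\<^sup>2 - c (k - 1) x - k c p\<close>. These have opposite signs, so the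
  sum of their absolute values is the square root of the discriminant.\<close>

lemma energy_multipartite:
  fixes part :: "'v \<Rightarrow> 'p"
  assumes V: "finite V" and P0: "P\<^sub>0 \<in> part ` V" "card {v \<in> V. part v = P\<^sub>0} = p"
    and P: "\<And>P. P \<in> part ` V - {P\<^sub>0} \<Longrightarrow> card {v \<in> V. part v = P} = c"
    and k: "card (part ` V - {P\<^sub>0}) = k" "k > 0"
  shows "energy (multipartite_graph V part) =
    real c * (real k - 1) + sqrt ((real c * (real k - 1))\<^sup>2 + 4 * (real k * c * p))"
proof -
  define s where "s = sqrt ((real (c * (k - 1)))\<^sup>2 + 4 * (k * c * p))"
  define r\<^sub>1 where "r\<^sub>1 = (real (c * (k - 1)) + s) / 2"
  define r\<^sub>2 where "r\<^sub>2 = (real (c * (k - 1)) - s) / 2"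
  have s2: "s\<^sup>2 = (real (c * (k - 1)))\<^sup>2 + 4 * (real k * c * p)"
    by (simp add: s_def)
  have s: "s \<ge> real (c * (k - 1))"
    unfolding s_def by (rule real_le_rsqrt) simp
  have vieta: "r\<^sub>1 + r\<^sub>2 = c * (k - 1)" "r\<^sub>1 * r\<^sub>2 = - (real k * c * p)"
    using s2 by (auto simp: r\<^sub>1_def r\<^sub>2_def field_simps power2_eq_square)
  obtain Q where parts: "part ` V = insert P\<^sub>0 Q" and Q: "finite Q" "P\<^sub>0 \<notin> Q" "card Q = k"
    and Pc: "\<And>P. P \<in> Q \<Longrightarrow> card {v \<in> V. part v = P} = c"
  proof (rule that[of "part ` V - {P\<^sub>0}"])
    show "part ` V = insert P\<^sub>0 (part ` V - {P\<^sub>0})"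
      using P0(1) by blast
  qed (use V P k in simp_all)
  obtain P\<^sub>1 where "P\<^sub>1 \<in> Q"
    using k(2) Q(3) by (metis card.empty equals0I less_irrefl)
  then have "{v \<in> V. part v = P\<^sub>1} \<noteq> {}" and "card {v \<in> V. part v = P\<^sub>1} = c"
    using Pc parts by (force, simp)
  then have c: "c > 0"
    using V by (auto simp: card_gt_0_iff)
  have p: "p > 0"
    using P0 V by (auto simp: card_gt_0_iff)
  have "char_poly (adjacency_matrix (multipartite_graph V part)) =
      [:0, 1:] ^ (p - 1 + (c - 1) * k) * ([:c, 1:] ^ (k - 1) * ([:- r\<^sub>1, 1:] * [:- r\<^sub>2, 1:]))" (is "_ = ?q")
  proof (rule poly_eq_if_eq_above)
    fix x :: real assume x: "x > 0"
    have "poly (char_poly (adjacency_matrix (multipartite_graph V part))) x =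
        x ^ (p - 1) * (x + p) * (x ^ (c - 1) * (x + c)) ^ k * (1 - (p / (x + p) + k * (c / (x + c))))"
      unfolding poly_char_poly_adjacency_multipartite[OF V x]
      using Q Pc P0(2) by (simp add: parts)
    also have "\<dots> = x ^ (p - 1 + (c - 1) * k) * (x + c) ^ (k - 1) *
        ((x + p) * (x + c) * (1 - (p / (x + p) + k * (c / (x + c)))))"
    proof -
      have "(x + c) ^ k = (x + c) ^ (k - 1) * (x + c)"
        using k(2) by (simp only: power_minus_mult)
      moreover have "(x ^ (c - 1)) ^ k = x ^ ((c - 1) * k)"
        by (simp only: power_mult)
      ultimately show ?thesis
        by (simp only: power_add power_mult_distrib mult_ac)
    qed
    also have "(x + p) * (x + c) * (1 - (p / (x + p) + k * (c / (x + c)))) =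
        (x + p) * (x + c) - p * (x + c) - k * c * (x + p)"
    proof -
      have "u * w * (1 - (p / u + k * (c / w))) = u * w - p * w - k * c * u"
        if "u \<noteq> 0" "w \<noteq> 0" for u w :: real
        using that by (simp add: field_simps)
      moreover have "x + p \<noteq> 0" "x + c \<noteq> 0"
        using x by linarith+
      ultimately show ?thesis by simp
    qed
    also have "\<dots> = x\<^sup>2 - real (c * (k - 1)) * x - k * c * p"
      using k(2) by (simp add: of_nat_diff algebra_simps power2_eq_square)
    also have "\<dots> = (x - r\<^sub>1) * (x - r\<^sub>2)"
      unfolding vieta(1)[symmetric] using vieta(2) by (simp add: algebra_simps power2_eq_square)
    finally show "poly (char_poly (adjacency_matrix (multipartite_graph V part))) x = poly ?q x"
      by (simp only: poly_mult poly_power) (simp add: algebra_simps)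
  qed
  then have "eigenvalues (adjacency_matrix (multipartite_graph V part)) =
      replicate_mset (p - 1 + (c - 1) * k) 0 + (replicate_mset (k - 1) (- real c) + {#r\<^sub>1, r\<^sub>2#})"
    unfolding eigenvalues_def
    by (simp only: proots_linear_power_mult proots_mult mult_eq_0_iff power_eq_0_iff pCons_eq_0_iff
        one_neq_zero simp_thms proots_power proots_linear_factor) simp
  then have "energy (multipartite_graph V part) = real (k - 1) * c + (\<bar>r\<^sub>1\<bar> + \<bar>r\<^sub>2\<bar>)"
    by (simp add: energy_def)
  also have "\<bar>r\<^sub>1\<bar> + \<bar>r\<^sub>2\<bar> = s"
  proof -
    have "\<bar>(t + s) / 2\<bar> + \<bar>(t - s) / 2\<bar> = s" if "0 \<le> t" "t \<le> s" for t
      using that by (simp add: field_simps)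
    then show ?thesis
      using s by (simp add: r\<^sub>1_def r\<^sub>2_def del: of_nat_mult)
  qed
  finally show ?thesis
    using k(2) by (simp add: s_def of_nat_diff algebra_simps)
qed

text \<open>The Laplacian eigenvalues are \<open>N - p\<close>, \<open>N - c\<close>, \<open>N\<close> and \<open>0\<close>, with multiplicities \<open>p - 1\<close>,
  \<open>k (c - 1)\<close>, \<open>k\<close> and \<open>1\<close>; the number \<open>d\<close> is the average degree.\<close>

lemma laplacian_energy_multipartite:
  fixes part :: "'v \<Rightarrow> 'p" and V :: "'v set"
  defines "N \<equiv> real (card V)"
  assumes V: "finite V" and P0: "P\<^sub>0 \<in> part ` V" "card {v \<in> V. part v = P\<^sub>0} = p"
    and P: "\<And>P. P \<in> part ` V - {P\<^sub>0} \<Longrightarrow> card {v \<in> V. part v = P} = c"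
    and k: "card (part ` V - {P\<^sub>0}) = k"
    and d: "d = (p * (N - p) + k * c * (N - c)) / N"
  shows "laplacian_energy (multipartite_graph V part) =
    (real p - 1) * \<bar>N - p - d\<bar> + k * (real c - 1) * \<bar>N - c - d\<bar> + k * \<bar>N - d\<bar> + \<bar>d\<bar>"
proof -
  let ?G = "multipartite_graph V part"
  obtain Q where parts: "part ` V = insert P\<^sub>0 Q" and Q: "finite Q" "P\<^sub>0 \<notin> Q" "card Q = k"
    and Pc: "\<And>P. P \<in> Q \<Longrightarrow> card {v \<in> V. part v = P} = c"
  proof (rule that[of "part ` V - {P\<^sub>0}"])
    show "part ` V = insert P\<^sub>0 (part ` V - {P\<^sub>0})"
      using P0(1) by blast
  qed (use V P k in simp_all)
  have p: "p > 0"
    using P0 V by (auto simp: card_gt_0_iff)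
  \<comment> \<open>For \<open>k = 0\<close> the number \<open>c\<close> is arbitrary, hence possibly zero.\<close>
  have c: "k * (c - 1 + 1) = k * c"
  proof (cases "k = 0")
    case False
    then obtain P\<^sub>1 where "P\<^sub>1 \<in> Q"
      using Q(3) by (metis card.empty equals0I)
    then have "{v \<in> V. part v = P\<^sub>1} \<noteq> {}" and "card {v \<in> V. part v = P\<^sub>1} = c"
      using Pc parts by (force, simp)
    then have "c > 0"
      using V by (auto simp: card_gt_0_iff)
    then show ?thesis by simp
  qed simp
  have degree: "real (vertex_degree ?G v) = N - card {w \<in> V. part w = part v}" if "v \<in> V" for v
    using vertex_degree_multipartite_graph[OF V that, of part] by (simp add: N_def)
  have "2 * real (card (edges ?G)) = (\<Sum>v\<in>V. real (vertex_degree ?G v))"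
    using sum_vertex_degree[OF simple_graph_multipartite_graph[OF V], of part]
    by (simp add: multipartite_graph_def flip: of_nat_sum)
  also have "\<dots> = (\<Sum>v\<in>V. N - card {w \<in> V. part w = part v})"
    using degree by simp
  also have "\<dots> = (\<Sum>P\<in>part ` V. card {v \<in> V. part v = P} * (N - card {w \<in> V. part w = P}))"
    by (subst sum.image_gen[OF V, of _ part]) (auto intro!: sum.cong)
  also have "\<dots> = p * (N - p) + k * c * (N - c)"
    using Q Pc P0(2) by (simp add: parts)
  finally have mean: "2 * real (card (edges ?G)) / real (card (vertices ?G)) = d"
    by (simp add: d N_def multipartite_graph_def)
  have "char_poly (laplacian_matrix ?G) =
      [:- (N - p), 1:] ^ (p - 1) * ([:- (N - c), 1:] ^ (k * (c - 1)) * ([:- N, 1:] ^ k * [:0, 1:]))"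
    (is "_ = ?q")
  proof (rule poly_eq_if_eq_above)
    fix x :: real assume x: "x > N"
    have "poly (char_poly (laplacian_matrix ?G)) x =
        (x - (N - p)) ^ (p - 1) * (x - N) * ((x - (N - c)) ^ (c - 1) * (x - N)) ^ k * (1 + N / (x - N))"
      unfolding poly_char_poly_laplacian_multipartite[OF V x[unfolded N_def]] N_def[symmetric]
      using Q Pc P0(2) by (simp add: parts)
    also have "\<dots> = (x - (N - p)) ^ (p - 1) * (x - (N - c)) ^ (k * (c - 1)) * (x - N) ^ k *
        ((x - N) * (1 + N / (x - N)))"
    proof -
      have "((x - (N - c)) ^ (c - 1)) ^ k = (x - (N - c)) ^ (k * (c - 1))"
        by (simp only: power_mult[symmetric] mult.commute)
      then show ?thesis
        by (simp only: power_mult_distrib mult_ac)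
    qed
    also have "(x - N) * (1 + N / (x - N)) = x"
      using x by (simp add: field_simps)
    finally show "poly (char_poly (laplacian_matrix ?G)) x = poly ?q x"
      by (simp add: algebra_simps)
  qed
  then have "eigenvalues (laplacian_matrix ?G) =
      replicate_mset (p - 1) (N - p) + (replicate_mset (k * (c - 1)) (N - c) + (replicate_mset k N + {#0#}))"
    unfolding eigenvalues_def
    by (simp only: proots_linear_power_mult proots_mult mult_eq_0_iff power_eq_0_iff pCons_eq_0_iff
        one_neq_zero simp_thms proots_power proots_linear_factor) simp
  then have "laplacian_energy ?G =
      real (p - 1) * \<bar>N - p - d\<bar> + real (k * (c - 1)) * \<bar>N - c - d\<bar> + k * \<bar>N - d\<bar> + \<bar>d\<bar>"
    unfolding laplacian_energy_def mean by simp
  moreover have "real (k * (c - 1)) = k * (real c - 1)"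
    using arg_cong[OF c, of real] by (simp add: algebra_simps)
  ultimately show ?thesis
    using p by (simp add: of_nat_diff)
qed

section \<open>The inequality between the two energies\<close>

text \<open>The left-hand side is \<open>c (k - 1) + c sqrt ((k - 1) (5 k - 1))\<close>. Both sides agree at \<open>k = 2\<close>, so the
  square root needs a bound that is sharp there: \<open>9 (k - 1)\<close> and \<open>5 k - 1\<close> coincide at \<open>k = 2\<close>, and the
  inequality between their geometric and arithmetic means gives \<open>(7 k - 5) / 3\<close>. The right-hand side
  divided by \<open>c\<close> is non-decreasing in \<open>c\<close>, hence bounded below by its value at \<open>c = 1\<close>. After division by \<open>c\<close>
  and clearing of denominators, the two bounds differ by \<open>(k - 2)\<^sup>2 (6 k - 2)\<close>.\<close>

lemma multipartite_energy_inequality: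
  fixes c k :: real
  assumes c: "c \<ge> 1" and k: "k \<ge> 2"
  defines "N \<equiv> c * (2 * k - 1)" and "p \<equiv> c * (k - 1)"
  defines "d \<equiv> (p * (N - p) + k * c * (N - c)) / N"
  shows "c * (k - 1) + sqrt ((c * (k - 1))\<^sup>2 + 4 * (k * c * p)) \<le>
    (p - 1) * \<bar>N - p - d\<bar> + k * (c - 1) * \<bar>N - c - d\<bar> + k * \<bar>N - d\<bar> + \<bar>d\<bar>"
proof -
  define D where "D = 2 * k - 1"
  have D: "D > 0" and N: "N = c * D" using k by (simp_all add: D_def N_def)
  have d: "d = 3 * c * k * (k - 1) / D"
  proof -
    have "p * (N - p) + k * c * (N - c) = c * (3 * c * k * (k - 1))"
      by (simp add: p_def N_def algebra_simps)
    then show ?thesis using c by (simp add: d_def N)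
  qed
  \<comment> \<open>For \<open>k \<ge> 2\<close> the eigenvalue \<open>N - p\<close> is at most the average degree \<open>d\<close>, while \<open>N - c\<close> and \<open>N\<close> are at least \<open>d\<close>.\<close>
  have eqs: "N - p - d = - (c * k * (k - 2) / D)" "N - c - d = c * (k - 1) * (k - 2) / D"
    "N - d = c * (k\<^sup>2 - k + 1) / D"
  proof -
    have quot: "X - Y / D = Z / D" if "X * D - Y = Z" for X Y Z
      using that D by (simp add: field_simps)
    have "N - p - d = - (c * k * (k - 2)) / D"
      unfolding d by (rule quot) (simp add: N_def p_def D_def algebra_simps)
    then show "N - p - d = - (c * k * (k - 2) / D)" by simp
    show "N - c - d = c * (k - 1) * (k - 2) / D"
      unfolding d by (rule quot) (simp add: N_def D_def algebra_simps)
    show "N - d = c * (k\<^sup>2 - k + 1) / D"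
      unfolding d by (rule quot) (simp add: N_def D_def algebra_simps power2_eq_square)
  qed
  have pos: "k\<^sup>2 - k + 1 \<ge> 0"
  proof -
    have "0 \<le> k * (k - 1) + 1" using k by simp
    then show ?thesis by (simp add: algebra_simps power2_eq_square)
  qed
  have "sqrt ((c * (k - 1))\<^sup>2 + 4 * (k * c * p)) \<le> c * (7 * k - 5) / 3"
  proof (rule real_le_lsqrt)
    have "(c * (7 * k - 5) / 3)\<^sup>2 - ((c * (k - 1))\<^sup>2 + 4 * (k * c * p)) = (2 * c * (k - 2) / 3)\<^sup>2"
      by (simp add: p_def field_simps power2_eq_square)
    then show "(c * (k - 1))\<^sup>2 + 4 * (k * c * p) \<le> (c * (7 * k - 5) / 3)\<^sup>2"
      by (metis diff_ge_0_iff_ge zero_le_power2)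
  qed (use c k in simp)
  then have "c * (k - 1) + sqrt ((c * (k - 1))\<^sup>2 + 4 * (k * c * p)) \<le> c * (10 * k - 8) / 3"
    by (simp add: algebra_simps)
  also have "\<dots> \<le> c * (k * (2 * k\<^sup>2 - 2 * k + 2)) / D"
  proof -
    have "3 * (k * (2 * k\<^sup>2 - 2 * k + 2)) - (10 * k - 8) * D = (k - 2)\<^sup>2 * (6 * k - 2)"
      by (simp add: D_def algebra_simps power2_eq_square)
    also have "\<dots> \<ge> 0" using k by simp
    finally have "(10 * k - 8) * D \<le> 3 * (k * (2 * k\<^sup>2 - 2 * k + 2))" by simp
    then have "(10 * k - 8) / 3 \<le> k * (2 * k\<^sup>2 - 2 * k + 2) / D"
      using D by (simp add: field_simps)
    from mult_left_mono[OF this, of c] show ?thesis using c by simp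
  qed
  also have "\<dots> \<le> c * (k * (k - 2) * (p - 1) + k * (c - 1) * ((k - 1) * (k - 2)) +
      k * (k\<^sup>2 - k + 1) + 3 * k * (k - 1)) / D"
  proof -
    have "1 * (k - 1) \<le> p"
      unfolding p_def using c k by (intro mult_right_mono) simp_all
    then have "k * (k - 2) * (k - 2) \<le> k * (k - 2) * (p - 1)"
      using k by (intro mult_left_mono) auto
    moreover have "0 \<le> k * (c - 1) * ((k - 1) * (k - 2))"
      using k c by simp
    ultimately have "k * (2 * k\<^sup>2 - 2 * k + 2) \<le> k * (k - 2) * (p - 1) +
        k * (c - 1) * ((k - 1) * (k - 2)) + k * (k\<^sup>2 - k + 1) + 3 * k * (k - 1)"
      by (simp add: algebra_simps power2_eq_square)
    then show ?thesis
      using c D by (intro divide_right_mono mult_left_mono) auto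
  qed
  also have "\<dots> = (p - 1) * (c * k * (k - 2) / D) + k * (c - 1) * (c * (k - 1) * (k - 2) / D) +
      k * (c * (k\<^sup>2 - k + 1) / D) + d"
    unfolding d by (simp only: times_divide_eq_right add_divide_distrib[symmetric])
      (simp only: algebra_simps)
  also have "\<dots> = (p - 1) * \<bar>N - p - d\<bar> + k * (c - 1) * \<bar>N - c - d\<bar> + k * \<bar>N - d\<bar> + \<bar>d\<bar>"
  proof -
    have "c * k * (k - 2) / D \<ge> 0" "c * (k - 1) * (k - 2) / D \<ge> 0" "c * (k\<^sup>2 - k + 1) / D \<ge> 0" "d \<ge> 0"
      using c k D pos by (simp_all add: d)
    then show ?thesis
      unfolding eqs by (simp only: abs_minus_cancel abs_of_nonneg)
  qed
  finally show ?thesis .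
qed

section \<open>Non-abelian groups with an abelian subgroup of index two\<close>

lemma centerI:
  assumes "z \<in> carrier G" "\<And>x. x \<in> carrier G \<Longrightarrow> z \<otimes>\<^bsub>G\<^esub> x = x \<otimes>\<^bsub>G\<^esub> z"
  shows "z \<in> center G"
  using assms by (simp add: center_def)

lemma center_carrier: "z \<in> center G \<Longrightarrow> z \<in> carrier G"
  by (simp add: center_def)

lemma center_commute: "z \<in> center G \<Longrightarrow> x \<in> carrier G \<Longrightarrow> z \<otimes>\<^bsub>G\<^esub> x = x \<otimes>\<^bsub>G\<^esub> z"
  unfolding center_def by blast

lemma (in group) subgroup_center: "subgroup (center G) G"
proof (rule subgroupI)
  show "center G \<subseteq> carrier G" by (rule subsetI) (rule center_carrier)
  have "\<one> \<in> center G" by (rule centerI) simp_all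
  then show "center G \<noteq> {}" by blast
next
  fix z assume z: "z \<in> center G"
  note zG = center_carrier[OF z]
  show "inv z \<in> center G"
  proof (rule centerI)
    fix x assume x: "x \<in> carrier G"
    have "inv z \<otimes> x = inv z \<otimes> (x \<otimes> z) \<otimes> inv z"
      using zG x by (simp add: m_assoc)
    also have "x \<otimes> z = z \<otimes> x"
      by (rule center_commute[OF z x, symmetric])
    also have "inv z \<otimes> (z \<otimes> x) \<otimes> inv z = x \<otimes> inv z"
      using zG x by (simp add: m_assoc[symmetric])
    finally show "inv z \<otimes> x = x \<otimes> inv z" .
  qed (use zG in simp)
next
  fix y z assume y: "y \<in> center G" and z: "z \<in> center G"
  note yG = center_carrier[OF y] and zG = center_carrier[OF z]
  show "y \<otimes> z \<in> center G"
  proof (rule centerI)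
    fix x assume x: "x \<in> carrier G"
    have "y \<otimes> z \<otimes> x = y \<otimes> (z \<otimes> x)"
      using yG zG x by (simp add: m_assoc)
    also have "z \<otimes> x = x \<otimes> z"
      by (rule center_commute[OF z x])
    also have "y \<otimes> (x \<otimes> z) = y \<otimes> x \<otimes> z"
      using yG zG x by (simp add: m_assoc)
    also have "y \<otimes> x = x \<otimes> y"
      by (rule center_commute[OF y x])
    also have "x \<otimes> y \<otimes> z = x \<otimes> (y \<otimes> z)"
      using yG zG x by (simp add: m_assoc)
    finally show "y \<otimes> z \<otimes> x = x \<otimes> (y \<otimes> z)" .
  qed (use yG zG in simp)
qed

text \<open>For a group that is not abelian, \<open>A\<close> is a proper subgroup, so the covering by \<open>A\<close> and one coset says
  that \<open>A\<close> has index two.\<close>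

locale nonabelian_with_abelian_index_two = group G for G (structure) +
  fixes A \<beta>
  assumes finite_carrier: "finite (carrier G)"
    and A: "subgroup A G"
    and A_commute: "\<And>x y. \<lbrakk>x \<in> A; y \<in> A\<rbrakk> \<Longrightarrow> x \<otimes> y = y \<otimes> x"
    and \<beta>: "\<beta> \<in> carrier G"
    and carrier_eq: "carrier G = A \<union> (A #> \<beta>)"
    and nonabelian: "center G \<noteq> carrier G"
begin

lemma A_subset: "A \<subseteq> carrier G"
  using A by (rule subgroup.subset)

lemma carrier_eq_outside:
  assumes "g \<in> carrier G" "g \<notin> A"
  shows "carrier G = A \<union> (A #> g)"
  using repr_independence[OF _ \<beta> A, of g] assms carrier_eq by auto

text \<open>The key observation: \<open>A\<close> together with any element outside it generates the whole group.\<close>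

lemma central_if_commutes_outside:
  assumes y: "y \<in> A" and g: "g \<in> carrier G" "g \<notin> A" and comm: "y \<otimes> g = g \<otimes> y"
  shows "y \<in> center G"
proof -
  have y': "y \<in> carrier G" using y A_subset by blast
  have "y \<otimes> x = x \<otimes> y" if "x \<in> A #> g" for x
  proof -
    obtain w where w: "w \<in> A" "x = w \<otimes> g" using \<open>x \<in> A #> g\<close> by (auto simp: r_coset_def)
    then have w': "w \<in> carrier G" using A_subset by blast
    have "y \<otimes> (w \<otimes> g) = w \<otimes> (y \<otimes> g)"
      using A_commute[OF y w(1)] y' w' g(1) by (simp add: m_assoc[symmetric])
    then show ?thesis using comm w y' w' g(1) by (simp add: m_assoc)
  qed
  then show ?thesis
    using A_commute[OF y] carrier_eq_outside[OF g] by (intro centerI y') auto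
qed

lemma center_subset: "center G \<subseteq> A"
proof
  fix z assume z: "z \<in> center G"
  show "z \<in> A"
  proof (rule ccontr)
    assume "z \<notin> A"
    note zG = center_carrier[OF z]
    have sub: "A \<subseteq> center G"
    proof
      fix y assume y: "y \<in> A"
      show "y \<in> center G"
        using central_if_commutes_outside[OF y zG \<open>z \<notin> A\<close>] center_commute[OF z, of y] y A_subset
        by auto
    qed
    have "A #> z \<subseteq> center G"
      using sub z subgroup.m_closed[OF subgroup_center] by (auto simp: r_coset_def)
    then have "carrier G \<subseteq> center G"
      using sub carrier_eq_outside[OF zG \<open>z \<notin> A\<close>] by blast
    then show False using nonabelian subgroup.subset[OF subgroup_center] by simp
  qed
qed

lemma \<beta>_notin: "\<beta> \<notin> A"
proof
  assume "\<beta> \<in> A"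
  then have "A #> \<beta> = A" by (intro coset_join2 \<beta> A)
  then have "carrier G = A" using carrier_eq by simp
  then have "center G = carrier G"
    using A_commute center_carrier by (auto intro: centerI)
  then show False using nonabelian by simp
qed

text \<open>For a non-central \<open>v\<close>, this is the centralizer of \<open>v\<close> if \<open>v\<close> lies in \<open>A\<close>, and the part of its
  centralizer outside \<open>A\<close> otherwise.\<close>

definition part :: "'a \<Rightarrow> 'a set" where
  "part v = (if v \<in> A then A else center G #> v)"

lemma mem_own_coset: "v \<in> carrier G \<Longrightarrow> v \<in> center G #> v"
  by (rule rcos_self[OF _ subgroup_center])

lemma part_eq_A_iff: "v \<in> carrier G \<Longrightarrow> part v = A \<longleftrightarrow> v \<in> A"
  using mem_own_coset by (auto simp: part_def)

lemma center_coset_outside: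
  assumes "v \<in> carrier G" "v \<notin> A"
  shows "center G #> v \<subseteq> carrier G - A"
proof
  fix w assume "w \<in> center G #> v"
  then obtain z where z: "z \<in> center G" "w = z \<otimes> v" by (auto simp: r_coset_def)
  then have "z \<in> A" using center_subset by blast
  have "w \<notin> A"
  proof
    assume "w \<in> A"
    then have "inv z \<otimes> w \<in> A"
      using \<open>z \<in> A\<close> A by (simp add: subgroup.m_closed subgroup.m_inv_closed)
    moreover have "inv z \<otimes> w = v"
      using z assms(1) \<open>z \<in> A\<close> A_subset by (auto simp: m_assoc[symmetric])
    ultimately show False using assms(2) by simp
  qed
  then show "w \<in> carrier G - A"
    using z \<open>z \<in> A\<close> A_subset assms(1) by auto
qed

text \<open>Two elements outside \<open>A\<close> differ by a factor in \<open>A\<close>, and they commute exactly when this factor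
  commutes with one of them, that is, when it is central.\<close>

lemma commute_outside_iff:
  assumes v: "v \<in> carrier G" "v \<notin> A" and w: "w \<in> carrier G" "w \<notin> A"
  shows "v \<otimes> w = w \<otimes> v \<longleftrightarrow> w \<in> center G #> v"
proof
  assume comm: "v \<otimes> w = w \<otimes> v"
  have "w \<in> A #> v" using carrier_eq_outside[OF v] w by blast
  then obtain y where y: "y \<in> A" "w = y \<otimes> v" by (auto simp: r_coset_def)
  then have y': "y \<in> carrier G" using A_subset by blast
  have "(v \<otimes> y) \<otimes> v = (y \<otimes> v) \<otimes> v"
    using comm y y' v(1) by (simp add: m_assoc)
  then have "y \<otimes> v = v \<otimes> y"
    using y' v(1) right_cancel[of v "v \<otimes> y" "y \<otimes> v"] by simp
  then have "y \<in> center G"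
    by (rule central_if_commutes_outside[OF y(1) v])
  then show "w \<in> center G #> v" using y by (auto simp: r_coset_def)
next
  assume "w \<in> center G #> v"
  then obtain z where z: "z \<in> center G" "w = z \<otimes> v" by (auto simp: r_coset_def)
  then have "z \<in> carrier G" "v \<otimes> z = z \<otimes> v"
    using center_carrier center_commute[of z G v] v(1) by auto
  then show "v \<otimes> w = w \<otimes> v"
    using z v(1) by (simp add: m_assoc[symmetric])
qed

lemma part_eq_iff_outside:
  assumes v: "v \<in> carrier G" "v \<notin> A" and w: "w \<in> carrier G"
  shows "part w = center G #> v \<longleftrightarrow> w \<in> center G #> v"
proof (cases "w \<in> A")
  case True
  then show ?thesis
    using center_coset_outside[OF v] mem_own_coset[OF v(1)] v(2) by (auto simp: part_def)
next
  case False
  then show ?thesis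
    using repr_independence[OF _ v(1) subgroup_center, of w] mem_own_coset[OF w]
    by (auto simp: part_def)
qed

lemma commute_iff_part_eq:
  assumes v: "v \<in> carrier G - center G" and w: "w \<in> carrier G - center G"
  shows "v \<otimes> w = w \<otimes> v \<longleftrightarrow> part v = part w"
proof (cases "v \<in> A"; cases "w \<in> A")
  assume "v \<in> A" "w \<in> A"
  then show ?thesis using A_commute by (simp add: part_def)
next
  assume "v \<in> A" "w \<notin> A"
  then have "v \<otimes> w \<noteq> w \<otimes> v" "part v \<noteq> part w"
    using central_if_commutes_outside[of v w] v w part_eq_A_iff[of w] by (auto simp: part_def)
  then show ?thesis by simp
next
  assume "v \<notin> A" "w \<in> A"
  then have "v \<otimes> w \<noteq> w \<otimes> v" "part v \<noteq> part w"
    using central_if_commutes_outside[of w v] v w part_eq_A_iff[of v] by (auto simp: part_def)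
  then show ?thesis by simp
next
  assume "v \<notin> A" "w \<notin> A"
  then show ?thesis
    using commute_outside_iff[of v w] part_eq_iff_outside[of v w] v w by (auto simp: part_def)
qed

lemma noncommuting_graph_multipartite:
  "noncommuting_graph G = multipartite_graph (carrier G - center G) part"
proof -
  let ?V = "carrier G - center G"
  have "x \<in> ?V \<and> y \<in> ?V \<and> x \<otimes> y \<noteq> y \<otimes> x \<longleftrightarrow> x \<in> ?V \<and> y \<in> ?V \<and> part x \<noteq> part y" for x y
    using commute_iff_part_eq[of x y] by auto
  then show ?thesis
    by (simp only: noncommuting_graph_def multipartite_graph_def)
qed

lemma card_carrier: "card (carrier G) = 2 * card A"
proof -
  have "finite A" using finite_carrier A_subset finite_subset by blast
  moreover have "A \<inter> (A #> \<beta>) = {}"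
  proof (rule ccontr)
    assume "A \<inter> (A #> \<beta>) \<noteq> {}"
    then obtain x h where x: "x \<in> A" and h: "h \<in> A" "x = h \<otimes> \<beta>"
      by (auto simp: r_coset_def)
    then have "inv h \<otimes> x \<in> A"
      using A by (simp add: subgroup.m_closed subgroup.m_inv_closed)
    moreover have "inv h \<otimes> x = \<beta>"
      using h A_subset \<beta> by (auto simp: m_assoc[symmetric])
    ultimately show False using \<beta>_notin by simp
  qed
  moreover have "card (A #> \<beta>) = card A"
    using card_rcosets_equal[of "A #> \<beta>" A] rcosetsI[OF A_subset \<beta>] A_subset by simp
  moreover have "finite (A #> \<beta>)"
    using finite_carrier carrier_eq by (metis finite_Un)
  ultimately show ?thesis
    by (subst carrier_eq) (simp add: card_Un_disjoint)
qed

text \<open>With \<open>c\<close> the order of the center, the part of \<open>A\<close> is \<open>A - center G\<close> and the other parts are the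
  cosets of the center outside \<open>A\<close>. There are \<open>k\<close> of these, and since they fill a set with as many
  elements as \<open>A\<close>, the order of \<open>A\<close> is \<open>k c\<close>; it exceeds \<open>c\<close> because \<open>A\<close> is not central.\<close>

lemma part_sizes:
  obtains c k where "c > 0" "k \<ge> 2"
    "card {v \<in> carrier G - center G. part v = A} = c * (k - 1)"
    "\<forall>P\<in>part ` (carrier G - center G) - {A}. card {v \<in> carrier G - center G. part v = P} = c"
    "card (part ` (carrier G - center G) - {A}) = k"
    "card (carrier G - center G) = c * (2 * k - 1)"
    "A \<in> part ` (carrier G - center G)"
proof -
  let ?V = "carrier G - center G"
  define c where "c = card (center G)"
  define k where "k = card (part ` ?V - {A})"
  have fin: "finite A" "finite (center G)" "finite ?V"
    using finite_subset[OF A_subset finite_carrier] finite_subset[OF center_subset] finite_carrier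
    by simp_all
  have c: "c > 0"
    using fin subgroup.one_closed[OF subgroup_center] by (auto simp: c_def card_gt_0_iff)
  have neq: "A \<noteq> center G"
  proof
    assume "A = center G"
    have "\<beta> \<in> center G"
    proof (rule centerI[OF \<beta>])
      fix x assume x: "x \<in> carrier G"
      show "\<beta> \<otimes> x = x \<otimes> \<beta>"
      proof (cases "x \<in> A")
        case True
        then show ?thesis
          using center_commute[of x G \<beta>] \<open>A = center G\<close> \<beta> by simp
      next
        case False
        then obtain z where z: "z \<in> center G" "x = z \<otimes> \<beta>"
          using x carrier_eq \<open>A = center G\<close> by (auto simp: r_coset_def)
        then have "\<beta> \<otimes> z = z \<otimes> \<beta>"
          using center_commute[of z G \<beta>] \<beta> by simp
        then show ?thesis
          using z(2) center_carrier[OF z(1)] \<beta> by (simp add: m_assoc[symmetric])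
      qed
    qed
    then show False using \<beta>_notin center_subset by blast
  qed
  then obtain y where "y \<in> A - center G" using center_subset by blast
  then have "y \<in> ?V" "part y = A" using A_subset by (auto simp: part_def)
  then have A_part: "A \<in> part ` ?V" by blast
  have fiber_A: "{v \<in> ?V. part v = A} = A - center G"
    using part_eq_A_iff A_subset by auto
  have fiber: "card {v \<in> ?V. part v = P} = c" if P: "P \<in> part ` ?V - {A}" for P
  proof -
    obtain v where v: "v \<in> carrier G" "v \<notin> A" "P = center G #> v"
      using P by (auto simp: part_def split: if_splits)
    have "{v \<in> ?V. part v = P} = P"
      using part_eq_iff_outside[OF v(1,2)] center_coset_outside[OF v(1,2)] center_subset
      unfolding v(3) by auto
    then show ?thesis
      using card_rcosets_equal[of P "center G"] rcosetsI[of "center G" v] v(1,3)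
        subgroup.subset[OF subgroup_center] by (simp add: c_def)
  qed
  have card_V: "card ?V = 2 * card A - c"
    using card_Diff_subset[OF fin(2)] card_carrier subgroup.subset[OF subgroup_center]
    by (simp add: c_def)
  \<comment> \<open>Counting the vertices by parts and comparing with \<open>card_V\<close> gives the order of \<open>A\<close>.\<close>
  have "card ?V = (\<Sum>P\<in>part ` ?V. card {v \<in> ?V. part v = P})"
    using sum.image_gen[OF fin(3), of "\<lambda>_. 1 :: nat" part] by simp
  also have "\<dots> = (\<Sum>P\<in>insert A (part ` ?V - {A}). card {v \<in> ?V. part v = P})"
    using A_part by (simp add: insert_absorb)
  also have "\<dots> = card A - c + k * c"
  proof -
    have "card {v \<in> ?V. part v = A} = card A - c"
      unfolding fiber_A c_def by (rule card_Diff_subset[OF fin(2) center_subset])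
    moreover have "(\<Sum>P\<in>part ` ?V - {A}. card {v \<in> ?V. part v = P}) = (\<Sum>P\<in>part ` ?V - {A}. c)"
      by (rule sum.cong) (use fiber in simp_all)
    ultimately show ?thesis
      using fin by (subst sum.insert) (simp_all add: k_def)
  qed
  finally have kc: "card A = k * c"
    using card_V card_mono[OF fin(1) center_subset] unfolding c_def[symmetric] by linarith
  have "c < k * c"
    using psubset_card_mono[OF fin(1), of "center G"] center_subset neq kc by (auto simp: c_def)
  then have "k \<noteq> 0" "k \<noteq> 1" by (intro notI; simp)+
  then have k: "k \<ge> 2" by linarith
  show ?thesis
  proof (rule that[of c k])
    show "card {v \<in> ?V. part v = A} = c * (k - 1)"
      unfolding fiber_A using fin center_subset kc
      by (simp add: card_Diff_subset c_def[symmetric] algebra_simps)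
    show "card ?V = c * (2 * k - 1)"
      using card_V kc by (simp add: algebra_simps)
  qed (rule c, rule k, rule ballI, erule fiber, rule k_def[symmetric], rule A_part)
qed

end

lemma (in nonabelian_with_abelian_index_two) energy_le_laplacian_energy:
  "energy (noncommuting_graph G) \<le> laplacian_energy (noncommuting_graph G)"
proof -
  let ?V = "carrier G - center G"
  obtain c k where c: "c > 0" and k: "k \<ge> 2"
    and p: "card {v \<in> ?V. part v = A} = c * (k - 1)"
    and fiber: "\<And>P. P \<in> part ` ?V - {A} \<Longrightarrow> card {v \<in> ?V. part v = P} = c"
    and parts: "card (part ` ?V - {A}) = k" and N: "card ?V = c * (2 * k - 1)"
    and A_part: "A \<in> part ` ?V"
    by (rule part_sizes) (rule that; (assumption | erule bspec; assumption))
  have fin: "finite ?V" using finite_carrier by simp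
  have real: "real (c * (k - 1)) = c * (real k - 1)" "real (card ?V) = c * (2 * real k - 1)"
    using k by (simp_all add: N of_nat_diff)
  have "energy (noncommuting_graph G) =
      real c * (real k - 1) + sqrt ((real c * (real k - 1))\<^sup>2 + 4 * (real k * c * (c * (real k - 1))))"
    unfolding noncommuting_graph_multipartite
    using energy_multipartite[OF fin A_part p fiber parts] k real(1) by simp
  also have "\<dots> \<le> laplacian_energy (noncommuting_graph G)"
    unfolding noncommuting_graph_multipartite
    by (subst laplacian_energy_multipartite[OF fin A_part p fiber parts HOL.refl], assumption,
        unfold real of_nat_mult[of k], rule multipartite_energy_inequality)
      (use c k in simp_all)
  finally show ?thesis .
qed

lemma sum_mset_abs_nonneg: "0 \<le> (\<Sum>x\<in>#M. \<bar>f x :: real\<bar>)"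
  by (induction M) auto

text \<open>The graph has no vertices, hence no eigenvalues.\<close>

lemma energy_le_laplacian_energy_if_abelian:
  assumes "center G = carrier G"
  shows "energy (noncommuting_graph G) \<le> laplacian_energy (noncommuting_graph G)"
proof -
  let ?A = "adjacency_matrix (noncommuting_graph G)"
  have "?A \<in> carrier_mat 0 0"
    using assms by (simp add: adjacency_matrix_def noncommuting_graph_def Let_def)
  then have "char_poly ?A = 1"
    unfolding char_poly_def by (intro det_dim_zero) simp
  then have "energy (noncommuting_graph G) = 0"
    by (simp add: energy_def eigenvalues_def)
  also have "0 \<le> laplacian_energy (noncommuting_graph G)"
    unfolding laplacian_energy_def by (rule sum_mset_abs_nonneg)
  finally show ?thesis .
qed


section \<open>Twisted dihedral groups\<close>

text \<open>The common shape of both families. Write \<open>z = \<beta>\<^sup>2\<close>; it is central and \<open>z\<^sup>2 = 1\<close>, and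
  \<open>\<beta> \<alpha> \<beta>\<^sup>-\<^sup>1 = \<alpha>\<^sup>r z\<close>. Generation is stated for right multiplication by \<open>\<alpha>\<close> and \<open>\<beta>\<close> only: both have finite
  order, so inverses need no separate closure condition.\<close>

locale twisted_dihedral = group G for G (structure) +
  fixes \<alpha> \<beta> and m r :: nat
  assumes \<alpha>: "\<alpha> \<in> carrier G" and \<beta>: "\<beta> \<in> carrier G"
    and \<alpha>_order: "\<alpha> [^] m = \<one>" and m: "m > 0"
    and \<beta>_order: "(\<beta> \<otimes> \<beta>) \<otimes> (\<beta> \<otimes> \<beta>) = \<one>"
    and square_commute: "(\<beta> \<otimes> \<beta>) \<otimes> \<alpha> = \<alpha> \<otimes> (\<beta> \<otimes> \<beta>)"
    and conj: "\<beta> \<otimes> \<alpha> = \<alpha> [^] r \<otimes> (\<beta> \<otimes> \<beta>) \<otimes> \<beta>"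
    and generated: "\<And>H. \<lbrakk>H \<subseteq> carrier G; \<one> \<in> H; \<And>x. x \<in> H \<Longrightarrow> x \<otimes> \<alpha> \<in> H; \<And>x. x \<in> H \<Longrightarrow> x \<otimes> \<beta> \<in> H\<rbrakk>
      \<Longrightarrow> H = carrier G"
begin

text \<open>The abelian subgroup generated by \<open>\<alpha>\<close> and \<open>\<beta>\<^sup>2\<close>. Non-negative exponents suffice because both
  generators have finite order.\<close>

definition A :: "'a set" where
  "A = {\<alpha> [^] i \<otimes> (\<beta> \<otimes> \<beta>) [^] j | (i :: nat) (j :: nat). True}"

lemma AI: "\<alpha> [^] i \<otimes> (\<beta> \<otimes> \<beta>) [^] j \<in> A" for i j :: nat
  by (auto simp: A_def)

lemma A_mult:
  "(\<alpha> [^] i \<otimes> (\<beta> \<otimes> \<beta>) [^] j) \<otimes> (\<alpha> [^] i' \<otimes> (\<beta> \<otimes> \<beta>) [^] j') = \<alpha> [^] (i + i') \<otimes> (\<beta> \<otimes> \<beta>) [^] (j + j')"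
  for i j i' j' :: nat
proof -
  let ?z = "\<beta> \<otimes> \<beta>"
  have z: "?z \<in> carrier G" using \<beta> by simp
  have "?z \<otimes> \<alpha> [^] i' = \<alpha> [^] i' \<otimes> ?z"
    by (rule group_commutes_pow[OF square_commute[symmetric] \<alpha> z, symmetric])
  then have "?z [^] j \<otimes> \<alpha> [^] i' = \<alpha> [^] i' \<otimes> ?z [^] j"
    by (rule group_commutes_pow[OF _ z]) (use \<alpha> in simp)
  then have "\<alpha> [^] i \<otimes> (?z [^] j \<otimes> \<alpha> [^] i') \<otimes> ?z [^] j' = \<alpha> [^] i \<otimes> (\<alpha> [^] i' \<otimes> ?z [^] j) \<otimes> ?z [^] j'"
    by simp
  then show ?thesis
    using \<alpha> z by (simp add: m_assoc nat_pow_mult[symmetric])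
qed

lemma \<alpha>_pow_mult: "\<alpha> [^] (m * i) = \<one>" for i :: nat
  using \<alpha> by (simp add: nat_pow_pow[symmetric] \<alpha>_order)

lemma square_pow_mult: "(\<beta> \<otimes> \<beta>) [^] (2 * j) = \<one>" for j :: nat
proof -
  have "(\<beta> \<otimes> \<beta>) [^] (2 :: nat) = \<one>"
    using \<beta> by (simp add: numeral_2_eq_2 \<beta>_order)
  then show ?thesis
    using \<beta> by (simp add: nat_pow_pow[symmetric])
qed

lemma A_subset: "A \<subseteq> carrier G"
  using \<alpha> \<beta> by (auto simp: A_def)

lemma A_commute: "x \<in> A \<Longrightarrow> y \<in> A \<Longrightarrow> x \<otimes> y = y \<otimes> x"
  by (auto simp: A_def A_mult add.commute)

lemma A_mult_closed:
  assumes "x \<in> A" "y \<in> A"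
  shows "x \<otimes> y \<in> A"
proof -
  obtain i j i' j' :: nat where "x = \<alpha> [^] i \<otimes> (\<beta> \<otimes> \<beta>) [^] j" "y = \<alpha> [^] i' \<otimes> (\<beta> \<otimes> \<beta>) [^] j'"
    using assms by (auto simp: A_def)
  then show ?thesis by (simp add: A_mult AI)
qed

lemma subgroup_A: "subgroup A G"
proof (rule subgroupI)
  show "A \<subseteq> carrier G" by (rule A_subset)
  show "A \<noteq> {}" using AI[of 0 0] by auto
  show "x \<otimes> y \<in> A" if "x \<in> A" "y \<in> A" for x y using that by (rule A_mult_closed)
  fix x assume "x \<in> A"
  then obtain i j :: nat where x: "x = \<alpha> [^] i \<otimes> (\<beta> \<otimes> \<beta>) [^] j" by (auto simp: A_def)
  let ?y = "\<alpha> [^] ((m - 1) * i) \<otimes> (\<beta> \<otimes> \<beta>) [^] j"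
  have "?y \<otimes> x = \<alpha> [^] (m * i) \<otimes> (\<beta> \<otimes> \<beta>) [^] (2 * j)"
  proof -
    have "(m - 1) * i + i = m * i" using m by (cases m) simp_all
    then show ?thesis by (simp add: x A_mult mult_2)
  qed
  then have "?y \<otimes> x = \<one>" by (simp add: \<alpha>_pow_mult square_pow_mult)
  then have "inv x = ?y"
    using A_subset \<open>x \<in> A\<close> AI by (intro inv_equality) auto
  then show "inv x \<in> A" by (simp add: AI)
qed

lemma finite_A: "finite A"
proof (rule finite_subset)
  show "A \<subseteq> (\<lambda>(i, j). \<alpha> [^] i \<otimes> (\<beta> \<otimes> \<beta>) [^] j) ` ({..<m} \<times> {..<2 :: nat})"
  proof
    fix x assume "x \<in> A"
    then obtain i j :: nat where x: "x = \<alpha> [^] i \<otimes> (\<beta> \<otimes> \<beta>) [^] j" by (auto simp: A_def)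
    have "\<alpha> [^] i = \<alpha> [^] (m * (i div m)) \<otimes> \<alpha> [^] (i mod m)"
      using \<alpha> by (simp add: nat_pow_mult)
    moreover have "(\<beta> \<otimes> \<beta>) [^] j = (\<beta> \<otimes> \<beta>) [^] (2 * (j div 2)) \<otimes> (\<beta> \<otimes> \<beta>) [^] (j mod 2)"
      using \<beta> by (subst nat_pow_mult) simp_all
    ultimately have "x = \<alpha> [^] (i mod m) \<otimes> (\<beta> \<otimes> \<beta>) [^] (j mod 2)"
      using \<alpha> \<beta> by (simp add: x \<alpha>_pow_mult square_pow_mult)
    then show "x \<in> (\<lambda>(i, j). \<alpha> [^] i \<otimes> (\<beta> \<otimes> \<beta>) [^] j) ` ({..<m} \<times> {..<2 :: nat})"
      using m by (auto intro!: image_eqI[of _ _ "(i mod m, j mod 2)"])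
  qed
qed simp

text \<open>The union of \<open>A\<close> and \<open>A \<beta>\<close> is closed under right multiplication by both generators, since
  \<open>w \<beta> \<alpha> = (w \<alpha>\<^sup>r z) \<beta>\<close> and \<open>w \<beta> \<beta> = w z\<close>.\<close>

lemma carrier_eq: "carrier G = A \<union> (A #> \<beta>)"
proof (rule HOL.sym, rule generated)
  have \<alpha>_A: "\<alpha> \<in> A" and \<alpha>_pow_A: "\<alpha> [^] i \<in> A" and z_A: "\<beta> \<otimes> \<beta> \<in> A" for i :: nat
    using AI[of 1 0] AI[of i 0] AI[of 0 1] \<alpha> \<beta> by simp_all
  show "A \<union> (A #> \<beta>) \<subseteq> carrier G"
    using A_subset r_coset_subset_G[OF A_subset \<beta>] by blast
  show "\<one> \<in> A \<union> (A #> \<beta>)"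
    using subgroup.one_closed[OF subgroup_A] by blast
  fix x assume "x \<in> A \<union> (A #> \<beta>)"
  then consider "x \<in> A" | w where "w \<in> A" "x = w \<otimes> \<beta>"
    by (auto simp: r_coset_def)
  note x_cases = this
  show "x \<otimes> \<alpha> \<in> A \<union> (A #> \<beta>)"
  proof (cases rule: x_cases)
    case 1
    then show ?thesis using A_mult_closed[OF _ \<alpha>_A] by simp
  next
    case 2
    have "x \<otimes> \<alpha> = w \<otimes> (\<alpha> [^] r \<otimes> (\<beta> \<otimes> \<beta>)) \<otimes> \<beta>"
      using 2 A_subset \<alpha> \<beta> conj by (auto simp: m_assoc)
    moreover have "w \<otimes> (\<alpha> [^] r \<otimes> (\<beta> \<otimes> \<beta>)) \<in> A"
      by (intro A_mult_closed 2 \<alpha>_pow_A z_A)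
    ultimately show ?thesis by (auto simp: r_coset_def)
  qed
  show "x \<otimes> \<beta> \<in> A \<union> (A #> \<beta>)"
  proof (cases rule: x_cases)
    case 1
    then show ?thesis by (auto simp: r_coset_def)
  next
    case 2
    then have "x \<otimes> \<beta> = w \<otimes> (\<beta> \<otimes> \<beta>)"
      using A_subset \<beta> by (auto simp: m_assoc)
    then show ?thesis using A_mult_closed[OF 2(1) z_A] by simp
  qed
qed

lemma energy_le_laplacian_energy:
  "energy (noncommuting_graph G) \<le> laplacian_energy (noncommuting_graph G)"
proof (cases "center G = carrier G")
  case True
  then show ?thesis by (rule energy_le_laplacian_energy_if_abelian)
next
  case False
  have "finite (A #> \<beta>)"
    using finite_A by (simp add: r_coset_def)
  then have "finite (carrier G)"
    using finite_A by (simp add: carrier_eq)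
  then have "nonabelian_with_abelian_index_two G A \<beta>"
    by (intro nonabelian_with_abelian_index_two.intro nonabelian_with_abelian_index_two_axioms.intro
        is_group subgroup_A A_commute \<beta> carrier_eq False)
  then show ?thesis
    by (rule nonabelian_with_abelian_index_two.energy_le_laplacian_energy)
qed

end

section \<open>The two presentations\<close>

text \<open>An isomorphism with the presented group amounts, for the present purpose, to an evaluation of words
  in \<open>G\<close>: a surjective monoid homomorphism from words that respects the relations. Surjectivity and
  the relations bound the group from above, and covering it by \<open>A\<close> and one coset is a bound of this
  kind.\<close>

locale word_evaluation = group G for G (structure) +
  fixes R :: "(gen word \<times> gen word) set" and ev :: "gen word \<Rightarrow> 'a"
  assumes ev_Nil: "ev [] = \<one>"
    and ev_append: "\<And>u v. ev (u @ v) = ev u \<otimes> ev v"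
    and ev_range: "range ev = carrier G"
    and ev_eq: "\<And>u v. word_eq R u v \<Longrightarrow> ev u = ev v"
begin

abbreviation \<alpha> :: 'a where "\<alpha> \<equiv> ev [Gen gen.a]"

abbreviation \<beta> :: 'a where "\<beta> \<equiv> ev [Gen gen.b]"

lemma ev_closed [simp]: "ev u \<in> carrier G"
  using ev_range by blast

lemma ev_relation:
  assumes "(u, v) \<in> R"
  shows "ev u = ev v"
  using ev_eq[OF word_eq.relation[OF assms, of "[]" "[]"]] by simp

lemma ev_Cons: "ev (x # y # u) = ev [x] \<otimes> ev (y # u)"
  using ev_append[of "[x]" "y # u"] by simp

lemma ev_Inv: "ev [Inv x] = inv (ev [Gen x])"
proof -
  have "ev [Inv x] \<otimes> ev [Gen x] = \<one>"
    using ev_eq[OF word_eq.cancel[of R "[]" "Inv x" "[]"]] by (simp add: ev_Cons ev_Nil)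
  then have "inv (ev [Gen x]) = ev [Inv x]"
    by (rule inv_equality) simp_all
  then show ?thesis by simp
qed

lemma ev_replicate: "ev (replicate i x) = ev [x] [^] i"
proof (induction i)
  case (Suc i)
  then show ?case
    using ev_append[of "replicate i x" "[x]"] by (simp add: replicate_append_same)
qed (simp add: ev_Nil)

lemma inv_\<alpha>:
  fixes m :: nat
  assumes "\<alpha> [^] m = \<one>" "m > 0"
  shows "inv \<alpha> = \<alpha> [^] (m - 1)"
  using assms nat_pow_Suc[of \<alpha> "m - 1"] by (intro inv_equality) simp_all

lemma inv_\<beta>:
  assumes "(\<beta> \<otimes> \<beta>) \<otimes> (\<beta> \<otimes> \<beta>) = \<one>"
  shows "inv \<beta> = \<beta> \<otimes> \<beta> \<otimes> \<beta>"
  using assms by (intro inv_equality) (simp_all add: m_assoc)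

text \<open>Every word can be read from left to right as a sequence of right multiplications by generators; an
  inverse letter is replaced by a power of the generator.\<close>

lemma generated:
  fixes m :: nat
  assumes \<alpha>_order: "\<alpha> [^] m = \<one>" "m > 0" and \<beta>_order: "(\<beta> \<otimes> \<beta>) \<otimes> (\<beta> \<otimes> \<beta>) = \<one>"
    and H: "H \<subseteq> carrier G" "\<one> \<in> H" "\<And>x. x \<in> H \<Longrightarrow> x \<otimes> \<alpha> \<in> H" "\<And>x. x \<in> H \<Longrightarrow> x \<otimes> \<beta> \<in> H"
  shows "H = carrier G"
proof -
  have pow: "x \<otimes> \<alpha> [^] i \<in> H" if "x \<in> H" for x and i :: nat
  proof (induction i)
    case 0
    then show ?case using that H(1) by (simp add: subset_iff)
  next
    case (Suc i)
    have "x \<otimes> \<alpha> [^] Suc i = (x \<otimes> \<alpha> [^] i) \<otimes> \<alpha>"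
      using that H(1) by (simp add: subset_iff m_assoc)
    then show ?case using H(3)[OF Suc] by simp
  qed
  have "ev u \<in> H" for u
  proof (induction u rule: rev_induct)
    case Nil
    then show ?case using H(2) by (simp add: ev_Nil)
  next
    case (snoc x u)
    have "ev u \<otimes> ev [x] \<in> H"
    proof (cases x)
      case (Gen g)
      then show ?thesis using H(3,4)[OF snoc] by (cases g) simp_all
    next
      case (Inv g)
      have "ev u \<otimes> \<beta> \<otimes> \<beta> \<otimes> \<beta> \<in> H"
        by (intro H(4) snoc)
      then show ?thesis
        using Inv pow[OF snoc, of "m - 1"]
        by (cases g) (simp_all add: ev_Inv inv_\<alpha>[OF \<alpha>_order] inv_\<beta>[OF \<beta>_order] m_assoc)
    qed
    then show ?case by (simp add: ev_append)
  qed
  then have "carrier G \<subseteq> H" unfolding ev_range[symmetric] by (rule image_subsetI)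
  with H(1) show ?thesis by (rule subset_antisym)
qed

text \<open>From \<open>\<beta> \<alpha> \<beta> = \<alpha>\<^sup>-\<^sup>1\<close> follows \<open>\<beta> \<alpha> = \<alpha>\<^sup>-\<^sup>1 \<beta>\<^sup>-\<^sup>1\<close>, and \<open>\<beta>\<^sup>-\<^sup>1 = \<beta>\<^sup>2 \<beta>\<close>. Substituting one form of the relation
  into the other gives \<open>\<alpha> = \<beta>\<^sup>2 \<alpha> \<beta>\<^sup>2\<close>, which is the centrality of \<open>\<beta>\<^sup>2\<close>.\<close>

lemma energy_le_laplacian_energy_V8n:
  assumes R: "R = {(replicate (2 * n) (Gen gen.a), []), (replicate 4 (Gen gen.b), []),
       ([Inv gen.b, Gen gen.a, Inv gen.b], [Gen gen.b, Gen gen.a, Gen gen.b]),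
       ([Gen gen.b, Gen gen.a, Gen gen.b], [Inv gen.a])}"
    and n: "n > 0"
  shows "energy (noncommuting_graph G) \<le> laplacian_energy (noncommuting_graph G)"
proof -
  let ?z = "\<beta> \<otimes> \<beta>"
  have \<alpha>_order: "\<alpha> [^] (2 * n) = \<one>"
    using ev_relation[of "replicate (2 * n) (Gen gen.a)" "[]"]
    by (simp add: R ev_replicate ev_Nil)
  have z_square: "?z \<otimes> ?z = \<one>"
  proof -
    have "\<beta> [^] (4 :: nat) = ev []"
      unfolding ev_replicate[symmetric] by (rule ev_relation) (simp add: R)
    then show ?thesis by (simp add: ev_Nil numeral_eq_Suc m_assoc)
  qed
  have conj_inv: "inv \<beta> \<otimes> (\<alpha> \<otimes> inv \<beta>) = \<beta> \<otimes> (\<alpha> \<otimes> \<beta>)"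
    using ev_relation[of "[Inv gen.b, Gen gen.a, Inv gen.b]" "[Gen gen.b, Gen gen.a, Gen gen.b]"]
    by (simp add: R ev_Cons ev_Inv)
  have conj: "\<beta> \<otimes> (\<alpha> \<otimes> \<beta>) = inv \<alpha>"
    using ev_relation[of "[Gen gen.b, Gen gen.a, Gen gen.b]" "[Inv gen.a]"]
    by (simp add: R ev_Cons ev_Inv)
  have "\<beta> \<otimes> \<alpha> = (\<beta> \<otimes> (\<alpha> \<otimes> \<beta>)) \<otimes> inv \<beta>"
    by (simp add: m_assoc)
  also have "\<dots> = \<alpha> [^] (2 * n - 1) \<otimes> (?z \<otimes> \<beta>)"
    using n by (simp only: conj inv_\<alpha>[OF \<alpha>_order] inv_\<beta>[OF z_square] mult_pos_pos zero_less_numeral)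
  finally have \<beta>\<alpha>: "\<beta> \<otimes> \<alpha> = \<alpha> [^] (2 * n - 1) \<otimes> ?z \<otimes> \<beta>"
    by (simp add: m_assoc)
  have "\<alpha> = \<beta> \<otimes> (inv \<beta> \<otimes> (\<alpha> \<otimes> inv \<beta>)) \<otimes> \<beta>"
  proof -
    have "\<beta> \<otimes> (inv \<beta> \<otimes> (\<alpha> \<otimes> inv \<beta>)) = \<alpha> \<otimes> inv \<beta>"
      by (simp add: m_assoc[symmetric])
    then show ?thesis by (simp add: m_assoc)
  qed
  also have "\<dots> = ?z \<otimes> \<alpha> \<otimes> ?z"
    unfolding conj_inv by (simp add: m_assoc)
  finally have "\<alpha> \<otimes> ?z = (?z \<otimes> \<alpha> \<otimes> ?z) \<otimes> ?z" by (rule arg_cong)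
  also have "\<dots> = ?z \<otimes> \<alpha> \<otimes> (?z \<otimes> ?z)"
    by (simp add: m_assoc)
  also have "\<dots> = ?z \<otimes> \<alpha>"
    unfolding z_square by simp
  finally have z\<alpha>: "?z \<otimes> \<alpha> = \<alpha> \<otimes> ?z" by (rule HOL.sym)
  have "0 < 2 * n" using n by simp
  then have "twisted_dihedral G \<alpha> \<beta> (2 * n) (2 * n - 1)"
    by (intro twisted_dihedral.intro twisted_dihedral_axioms.intro is_group ev_closed
        \<alpha>_order z_square z\<alpha> \<beta>\<alpha> generated[OF \<alpha>_order _ z_square])
  then show ?thesis by (rule twisted_dihedral.energy_le_laplacian_energy)
qed

text \<open>Here \<open>\<beta>\<^sup>2 = 1\<close>, so \<open>\<beta> \<alpha> \<beta> = \<alpha>\<^sup>2\<^sup>n\<^sup>-\<^sup>1\<close> is already the required conjugation relation.\<close>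

lemma energy_le_laplacian_energy_SD8n:
  assumes R: "R = {(replicate (4 * n) (Gen gen.a), []), (replicate 2 (Gen gen.b), []),
       ([Gen gen.b, Gen gen.a, Gen gen.b], replicate (2 * n - 1) (Gen gen.a))}"
    and n: "n > 0"
  shows "energy (noncommuting_graph G) \<le> laplacian_energy (noncommuting_graph G)"
proof -
  have \<alpha>_order: "\<alpha> [^] (4 * n) = \<one>"
    using ev_relation[of "replicate (4 * n) (Gen gen.a)" "[]"]
    by (simp add: R ev_replicate ev_Nil)
  have square: "\<beta> \<otimes> \<beta> = \<one>"
  proof -
    have "\<beta> [^] (2 :: nat) = ev []"
      unfolding ev_replicate[symmetric] by (rule ev_relation) (simp add: R)
    then show ?thesis by (simp add: ev_Nil numeral_eq_Suc)
  qed
  have conj: "\<beta> \<otimes> (\<alpha> \<otimes> \<beta>) = \<alpha> [^] (2 * n - 1)"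
    using ev_relation[of "[Gen gen.b, Gen gen.a, Gen gen.b]" "replicate (2 * n - 1) (Gen gen.a)"]
    by (simp add: R ev_Cons ev_replicate)
  have "\<beta> \<otimes> \<alpha> = (\<beta> \<otimes> (\<alpha> \<otimes> \<beta>)) \<otimes> \<beta>"
    by (simp add: m_assoc square)
  then have \<beta>\<alpha>: "\<beta> \<otimes> \<alpha> = \<alpha> [^] (2 * n - 1) \<otimes> (\<beta> \<otimes> \<beta>) \<otimes> \<beta>"
    by (simp add: conj square)
  have z_square: "\<beta> \<otimes> \<beta> \<otimes> (\<beta> \<otimes> \<beta>) = \<one>" and z\<alpha>: "\<beta> \<otimes> \<beta> \<otimes> \<alpha> = \<alpha> \<otimes> (\<beta> \<otimes> \<beta>)"
    by (simp_all add: square)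
  have "0 < 4 * n" using n by simp
  then have "twisted_dihedral G \<alpha> \<beta> (4 * n) (2 * n - 1)"
    by (intro twisted_dihedral.intro twisted_dihedral_axioms.intro is_group ev_closed
        \<alpha>_order z_square z\<alpha> \<beta>\<alpha> generated[OF \<alpha>_order _ z_square])
  then show ?thesis by (rule twisted_dihedral.energy_le_laplacian_energy)
qed

end

lemma word_evaluation_if_iso:
  fixes G :: "('a, 'b) monoid_scheme" and R :: "(gen word \<times> gen word) set"
  assumes "group G" and iso: "G \<cong> presented_group R"
  shows "\<exists>ev. word_evaluation G R ev"
proof -
  interpret G: group G by fact
  obtain h where h: "h \<in> Group.iso (presented_group R) G"
    using group.iso_sym[OF assms] by (auto simp: is_iso_def)
  then have hom: "h \<in> hom (presented_group R) G" and surj: "h ` carrier (presented_group R) = carrier G"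
    by (auto simp: Group.iso_def bij_betw_def)
  define ev :: "gen word \<Rightarrow> 'a" where "ev = (\<lambda>u. h (word_rel R `` {u}))"
  have "word_evaluation G R ev"
  proof
    show "ev [] = \<one>\<^bsub>G\<^esub>"
      using hom_one[OF hom group_presented_group assms(1)] by (simp add: ev_def presented_group_one)
    show "ev (u @ v) = ev u \<otimes>\<^bsub>G\<^esub> ev v" for u v
      using hom_mult[OF hom, of "word_rel R `` {u}" "word_rel R `` {v}"]
      by (simp add: ev_def presented_group_mult presented_group_carrier)
    show "range ev = carrier G"
      using surj by (simp add: ev_def presented_group_carrier image_image)
    show "ev u = ev v" if "word_eq R u v" for u v
      unfolding ev_def using that by (simp only: word_class_eq_iff[THEN iffD2])
  qed
  then show ?thesis by (rule exI[of _ ev])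
qed

theorem theorem4p3:
  fixes G :: "('a, 'b) monoid_scheme" and n :: nat
  assumes "group G"
    and "(odd n \<and> G \<cong> V8n n) \<or> (n \<ge> 2 \<and> G \<cong> SD8n n)"
  shows "energy (noncommuting_graph G) \<le> laplacian_energy (noncommuting_graph G)"
  using assms(2)
proof (elim disjE conjE)
  assume "odd n" and iso: "G \<cong> V8n n"
  then have "n > 0" by (cases n) simp_all
  obtain ev where "word_evaluation G
      {(replicate (2 * n) (Gen gen.a), []), (replicate 4 (Gen gen.b), []),
       ([Inv gen.b, Gen gen.a, Inv gen.b], [Gen gen.b, Gen gen.a, Gen gen.b]),
       ([Gen gen.b, Gen gen.a, Gen gen.b], [Inv gen.a])} ev"
    using word_evaluation_if_iso[OF assms(1) iso[unfolded V8n_def]] by blast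
  then show ?thesis
    by (rule word_evaluation.energy_le_laplacian_energy_V8n[OF _ HOL.refl \<open>n > 0\<close>])
next
  assume "n \<ge> 2" and iso: "G \<cong> SD8n n"
  then have "n > 0" by simp
  obtain ev where "word_evaluation G
      {(replicate (4 * n) (Gen gen.a), []), (replicate 2 (Gen gen.b), []),
       ([Gen gen.b, Gen gen.a, Gen gen.b], replicate (2 * n - 1) (Gen gen.a))} ev"
    using word_evaluation_if_iso[OF assms(1) iso[unfolded SD8n_def]] by blast
  then show ?thesis
    by (rule word_evaluation.energy_le_laplacian_energy_SD8n[OF _ HOL.refl \<open>n > 0\<close>])
qed

end
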